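(* Let $A$ be a bimonoidal weak bialgebra. Then for $\sigma=L$ and $\sigma=R$: (i) $\varepsilon|_{A_\sigma}$ is nondegenerate and $\mathrm{Ind}(\varepsilon|_{A_\sigma})=1$. (ii) The quasi-basis $x^i_\sigma\otimes y^i_\sigma\in A_\sigma\otimes A_\sigma$ of $\varepsilon|_{A_\sigma}$ is given by $$x_L^i\otimes y_L^i=S_R(1_{(1)})\otimes1_{(2)},\qquad x_R^i\otimes y_R^i=1_{(1)}\otimes S_L(1_{(2)}).$$ (iii) The modular automorphisms of $\varepsilon|_{A_L}$ and $\varepsilon|_{A_R}$ are given by $S_R\circ S_L\in\mathrm{Aut}\,A_L$ and $\bar S_L\circ\bar S_R\in\mathrm{Aut}\,A_R$, respectively. (iv) $A_L$ and $A_R$ are separable $K$-algebras, whence semisimple.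
   Context: $K$ is a field and all spaces are finite dimensional over $K$. A weak bialgebra $(A,1,\Delta,\varepsilon)$ is a unital associative $K$-algebra $(A,1)$ which is also a coassociative coalgebra with coproduct $\Delta$ and counit $\varepsilon$, such that $\Delta(ab)=\Delta(a)\Delta(b)$ for all $a,b$; neither $\Delta(1)=1\otimes1$ nor multiplicativity of $\varepsilon$ is required. Sweedler notation is used. $A$ is bimonoidal if $\varepsilon(abc)=\varepsilon(ab_{(1)})\varepsilon(b_{(2)}c)=\varepsilon(ab_{(2)})\varepsilon(b_{(1)}c)$ for all $a,b,c\in A$ (monoidal) and $(\Delta(1)\otimes1)(1\otimes\Delta(1))=1_{(1)}\otimes1_{(2)}\otimes1_{(3)}=(1\otimes\Delta(1))(\Delta(1)\otimes1)$ (comonoidal). With $\hat A=\mathrm{Hom}_K(A,K)$, $A_L=\{\langle\phi\mid1_{(1)}\rangle1_{(2)}:\phi\in\hat A\}$ and $A_R=\{1_{(1)}\langle\phi\mid1_{(2)}\rangle:\phi\in\hat A\}$; in the comonoidal case they are commuting unital subalgebras and $\Delta(1)\in A_R\otimes A_L$. The maps $S_L,\bar S_L:A_L\to A_R$ and $S_R,\bar S_R:A_R\to A_L$ are $S_L(a)=1_{(1)}\varepsilon(a1_{(2)})$, $\bar S_L(a)=1_{(1)}\varepsilon(1_{(2)}a)$ for $a\in A_L$, and $S_R(b)=\varepsilon(1_{(1)}b)1_{(2)}$, $\bar S_R(b)=\varepsilon(b1_{(1)})1_{(2)}$ for $b\in A_R$. A functional $\omega:M\to K$ on a finite dimensional algebra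 $M$ is nondegenerate if the bilinear form $(m,n)\mapsto\omega(mn)$ is nondegenerate. Its quasi-basis is the unique element $x_i\otimes y_i\in M\otimes M$ (summation over $i$ understood) with $\omega(mx_i)y_i=m=x_i\omega(y_im)$ for all $m\in M$; its index is $\mathrm{Ind}\,\omega=x_iy_i$. Its modular automorphism is the unique $\theta_\omega\in\mathrm{Aut}\,M$ with $\omega(xy)=\omega(y\,\theta_\omega(x))$ for all $x,y\in M$. *)

theory Defs
  imports Complex_Main "HOL-Library.Function_Algebras" "HOL-Library.FuncSet"
begin

text \<open>
  The ground field is \<open>'k\<close>, acting on \<open>'a\<close> through an explicit map \<open>scale\<close>.  The sort
  \<open>{ring, monoid_mult}\<close> is that of unital rings; unlike \<open>ring_1\<close> it does not exclude the zero
  algebra.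
\<close>

locale fin_dim_algebra = vector_space scale
  for scale :: "'k::field \<Rightarrow> 'a::{ring,monoid_mult} \<Rightarrow> 'a" (infixr \<open>*s\<close> 75) +
  assumes scale_mult_left: "(c *s x) * y = c *s (x * y)"
    and scale_mult_right: "x * (c *s y) = c *s (x * y)"
    and finite_dimensional: "\<exists>B. finite B \<and> span B = UNIV"


section \<open>Tensor products\<close>

text \<open>
  The pure tensor \<open>x \<otimes> y\<close> is the functional \<open>\<beta> \<mapsto> \<beta> x y\<close> on bilinear forms, and the tensor
  product \<open>M \<otimes> N\<close> of two subspaces of \<open>'a\<close> consists of the finite sums of pure tensors of their
  elements.  Over a field this is the usual tensor product, because functionals separate points;
  \<open>sweedler_sum_pure\<close> below is its universal property.  Tensors are made extensional by the value 0
  outside the bilinear forms, and are added pointwise (\<open>Function_Algebras\<close>).  Three-fold tensors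
  are obtained in the same way from trilinear forms.
\<close>

type_synonym ('a, 'k) tensor = "('a \<Rightarrow> 'a \<Rightarrow> 'k) \<Rightarrow> 'k"
type_synonym ('a, 'k) tensor3 = "('a \<Rightarrow> 'a \<Rightarrow> 'a \<Rightarrow> 'k) \<Rightarrow> 'k"

definition bilinear_map ::
  "('k::field \<Rightarrow> 'a::ab_group_add \<Rightarrow> 'a) \<Rightarrow> ('k \<Rightarrow> 'v::ab_group_add \<Rightarrow> 'v) \<Rightarrow> ('a \<Rightarrow> 'a \<Rightarrow> 'v) \<Rightarrow> bool"
  where "bilinear_map s t f \<longleftrightarrow>
    (\<forall>y. Vector_Spaces.linear s t (\<lambda>x. f x y)) \<and> (\<forall>x. Vector_Spaces.linear s t (\<lambda>y. f x y))"

definition trilinear_map ::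
  "('k::field \<Rightarrow> 'a::ab_group_add \<Rightarrow> 'a) \<Rightarrow> ('k \<Rightarrow> 'v::ab_group_add \<Rightarrow> 'v) \<Rightarrow> ('a \<Rightarrow> 'a \<Rightarrow> 'a \<Rightarrow> 'v) \<Rightarrow> bool"
  where "trilinear_map s t f \<longleftrightarrow>
    (\<forall>y z. Vector_Spaces.linear s t (\<lambda>x. f x y z)) \<and>
    (\<forall>x z. Vector_Spaces.linear s t (\<lambda>y. f x y z)) \<and>
    (\<forall>x y. Vector_Spaces.linear s t (\<lambda>z. f x y z))"

definition tensor_scale :: "'k::field \<Rightarrow> ('b \<Rightarrow> 'k) \<Rightarrow> ('b \<Rightarrow> 'k)"
  where "tensor_scale c t = (\<lambda>\<beta>. c * t \<beta>)"

context
  fixes scale :: "'k::field \<Rightarrow> 'a::{ring,monoid_mult} \<Rightarrow> 'a" (infixr \<open>*s\<close> 75)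
begin

definition pure :: "'a \<Rightarrow> 'a \<Rightarrow> ('a, 'k) tensor" (infix \<open>\<otimes>\<close> 70)
  where "x \<otimes> y = (\<lambda>\<beta>. if bilinear_map scale (*) \<beta> then \<beta> x y else 0)"

definition pure3 :: "'a \<Rightarrow> 'a \<Rightarrow> 'a \<Rightarrow> ('a, 'k) tensor3"
  where "pure3 x y z = (\<lambda>\<tau>. if trilinear_map scale (*) \<tau> then \<tau> x y z else 0)"

definition tensor_product :: "'a set \<Rightarrow> 'a set \<Rightarrow> ('a, 'k) tensor set"
  where "tensor_product M N =
    {t. \<exists>(n::nat) x y. (\<forall>i<n. x i \<in> M \<and> y i \<in> N) \<and> t = (\<Sum>i<n. x i \<otimes> y i)}"

text \<open>
  \<open>sweedler f t\<close> is the value \<open>f t\<^sub>(\<^sub>1\<^sub>) t\<^sub>(\<^sub>2\<^sub>)\<close>: the linear extension of a bilinear map \<open>f\<close> to tensors.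
  It is meaningful only for bilinear \<open>f\<close>, where the result does not depend on the decomposition
  of \<open>t\<close>.
\<close>

definition sweedler :: "('a \<Rightarrow> 'a \<Rightarrow> 'v::comm_monoid_add) \<Rightarrow> ('a, 'k) tensor \<Rightarrow> 'v"
  where "sweedler f t =
    (THE v. \<forall>(n::nat) x y. t = (\<Sum>i<n. x i \<otimes> y i) \<longrightarrow> v = (\<Sum>i<n. f (x i) (y i)))"

end

lemma linear_functional_separates:
  fixes t :: "'k::field \<Rightarrow> 'v::ab_group_add \<Rightarrow> 'v"
  assumes "vector_space t" "v \<noteq> 0"
  shows "\<exists>\<phi>. Vector_Spaces.linear t (*) \<phi> \<and> \<phi> v \<noteq> (0::'k)"
proof -
  interpret V: vector_space t by fact
  interpret K: vector_space "(*) :: 'k \<Rightarrow> 'k \<Rightarrow> 'k"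
    by (simp add: vector_space_def algebra_simps)
  interpret P: vector_space_pair t "(*) :: 'k \<Rightarrow> 'k \<Rightarrow> 'k" ..
  have "V.independent {v}"
    using assms(2) by simp
  from P.linear_independent_extend[OF this, of "\<lambda>_. 1"] show ?thesis
    by force
qed

lemma sum_fun_app: "(\<Sum>i\<in>I. f i) b = (\<Sum>i\<in>I. f i b)"
  for f :: "'i \<Rightarrow> 'b \<Rightarrow> 'c::comm_monoid_add"
  by (induction I rule: infinite_finite_induct) auto

lemma sweedler_sum_pure:
  fixes scale :: "'k::field \<Rightarrow> 'a::{ring,monoid_mult} \<Rightarrow> 'a"
    and scale' :: "'k \<Rightarrow> 'v::ab_group_add \<Rightarrow> 'v"
    and n :: nat
  assumes V: "vector_space scale'" and f: "bilinear_map scale scale' f"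
  shows "sweedler scale f (\<Sum>i<n. pure scale (x i) (y i)) = (\<Sum>i<n. f (x i) (y i))"
proof -
  have well_defined: "(\<Sum>i<n. f (x i) (y i)) = (\<Sum>j<m. f (u j) (v j))"
    if eq: "(\<Sum>i<n. pure scale (x i) (y i)) = (\<Sum>j<m. pure scale (u j) (v j))"
    for m :: nat and u v
  proof (rule ccontr)
    assume "\<not> ?thesis"
    then obtain \<phi> where \<phi>: "Vector_Spaces.linear scale' (*) \<phi>"
      and ne: "\<phi> ((\<Sum>i<n. f (x i) (y i)) - (\<Sum>j<m. f (u j) (v j))) \<noteq> 0"
      using linear_functional_separates[OF V, of "(\<Sum>i<n. f (x i) (y i)) - (\<Sum>j<m. f (u j) (v j))"] by auto
    interpret \<phi>: Vector_Spaces.linear scale' "(*)" \<phi> by fact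
    have "bilinear_map scale (*) (\<lambda>a b. \<phi> (f a b))"
      using f Vector_Spaces.linear_compose[OF _ \<phi>] unfolding bilinear_map_def o_def by blast
    with fun_cong[OF eq, of "\<lambda>a b. \<phi> (f a b)"] ne show False
      by (simp add: sum_fun_app pure_def \<phi>.diff \<phi>.sum)
  qed
  show ?thesis
    unfolding sweedler_def
  proof (rule the_equality)
    fix w
    assume "\<forall>(m::nat) u v. (\<Sum>i<n. pure scale (x i) (y i)) = (\<Sum>j<m. pure scale (u j) (v j)) \<longrightarrow>
      w = (\<Sum>j<m. f (u j) (v j))"
    then show "w = (\<Sum>i<n. f (x i) (y i))"
      by simp
  qed (intro allI impI, rule well_defined)
qed


section \<open>Weak bialgebras\<close>

locale weak_bialgebra = fin_dim_algebra scale
  for scale :: "'k::field \<Rightarrow> 'a::{ring,monoid_mult} \<Rightarrow> 'a" (infixr \<open>*s\<close> 75) +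
  fixes \<Delta> :: "'a \<Rightarrow> ('a, 'k) tensor" and \<epsilon> :: "'a \<Rightarrow> 'k"
  assumes coproduct_range: "\<Delta> a \<in> tensor_product scale UNIV UNIV"
    and coproduct_linear: "Vector_Spaces.linear scale tensor_scale \<Delta>"
    and counit_linear: "Vector_Spaces.linear scale (*) \<epsilon>"
    and coassoc:
      "sweedler scale (\<lambda>x z. sweedler scale (\<lambda>u v. pure3 scale u v z) (\<Delta> x)) (\<Delta> a) =
       sweedler scale (\<lambda>x z. sweedler scale (\<lambda>u v. pure3 scale x u v) (\<Delta> z)) (\<Delta> a)"
    and counit_left: "sweedler scale (\<lambda>x y. \<epsilon> x *s y) (\<Delta> a) = a"
    and counit_right: "sweedler scale (\<lambda>x y. \<epsilon> y *s x) (\<Delta> a) = a"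
    and coproduct_mult:
      "\<Delta> (a * b) =
       sweedler scale (\<lambda>x y. sweedler scale (\<lambda>u v. pure scale (x * u) (y * v)) (\<Delta> b)) (\<Delta> a)"

text \<open>
  With \<open>\<Delta> 1 = x \<otimes> y = u \<otimes> v\<close>, the products \<open>(\<Delta> 1 \<otimes> 1) (1 \<otimes> \<Delta> 1)\<close> and \<open>(1 \<otimes> \<Delta> 1) (\<Delta> 1 \<otimes> 1)\<close>
  in \<open>A \<otimes> A \<otimes> A\<close> are \<open>x \<otimes> y * u \<otimes> v\<close> and \<open>x \<otimes> u * y \<otimes> v\<close>.
\<close>

locale bimonoidal_weak_bialgebra = weak_bialgebra scale \<Delta> \<epsilon>
  for scale :: "'k::field \<Rightarrow> 'a::{ring,monoid_mult} \<Rightarrow> 'a" (infixr \<open>*s\<close> 75)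
    and \<Delta> :: "'a \<Rightarrow> ('a, 'k) tensor" and \<epsilon> :: "'a \<Rightarrow> 'k" +
  assumes monoidal_12:
      "\<epsilon> (a * b * c) = sweedler scale (\<lambda>x y. \<epsilon> (a * x) * \<epsilon> (y * c)) (\<Delta> b)"
    and monoidal_21:
      "\<epsilon> (a * b * c) = sweedler scale (\<lambda>x y. \<epsilon> (a * y) * \<epsilon> (x * c)) (\<Delta> b)"
    and comonoidal_left_right:
      "sweedler scale (\<lambda>x y. sweedler scale (\<lambda>u v. pure3 scale x (y * u) v) (\<Delta> 1)) (\<Delta> 1) =
       sweedler scale (\<lambda>x z. sweedler scale (\<lambda>u v. pure3 scale u v z) (\<Delta> x)) (\<Delta> 1)"
    and comonoidal_right_left:
      "sweedler scale (\<lambda>x y. sweedler scale (\<lambda>u v. pure3 scale x (u * y) v) (\<Delta> 1)) (\<Delta> 1) =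
       sweedler scale (\<lambda>x z. sweedler scale (\<lambda>u v. pure3 scale u v z) (\<Delta> x)) (\<Delta> 1)"

context
  fixes scale :: "'k::field \<Rightarrow> 'a::{ring,monoid_mult} \<Rightarrow> 'a" (infixr \<open>*s\<close> 75)
    and \<Delta> :: "'a \<Rightarrow> ('a, 'k) tensor"
begin

definition A_L :: "'a set"
  where "A_L = {sweedler scale (\<lambda>x y. \<phi> x *s y) (\<Delta> 1) | \<phi>. Vector_Spaces.linear scale (*) \<phi>}"

definition A_R :: "'a set"
  where "A_R = {sweedler scale (\<lambda>x y. \<phi> y *s x) (\<Delta> 1) | \<phi>. Vector_Spaces.linear scale (*) \<phi>}"

text \<open>
  The following formulas make sense on all of \<open>A\<close>.  They are used for \<open>S\<^sub>L\<close>, \<open>S'\<^sub>L\<close> on \<open>A\<^sub>L\<close> and for \<open>S\<^sub>R\<close>,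
  \<open>S'\<^sub>R\<close> on \<open>A\<^sub>R\<close> only, where \<open>S'\<close> stands for \<open>S\<close> with a bar.
\<close>

definition S_L :: "('a \<Rightarrow> 'k) \<Rightarrow> 'a \<Rightarrow> 'a"
  where "S_L \<epsilon> a = sweedler scale (\<lambda>x y. \<epsilon> (a * y) *s x) (\<Delta> 1)"

definition S'_L :: "('a \<Rightarrow> 'k) \<Rightarrow> 'a \<Rightarrow> 'a"
  where "S'_L \<epsilon> a = sweedler scale (\<lambda>x y. \<epsilon> (y * a) *s x) (\<Delta> 1)"

definition S_R :: "('a \<Rightarrow> 'k) \<Rightarrow> 'a \<Rightarrow> 'a"
  where "S_R \<epsilon> b = sweedler scale (\<lambda>x y. \<epsilon> (x * b) *s y) (\<Delta> 1)"

definition S'_R :: "('a \<Rightarrow> 'k) \<Rightarrow> 'a \<Rightarrow> 'a"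
  where "S'_R \<epsilon> b = sweedler scale (\<lambda>x y. \<epsilon> (b * x) *s y) (\<Delta> 1)"

end


section \<open>Functionals on finite dimensional algebras\<close>

text \<open>
  Algebras \<open>M\<close> are given as unital subalgebras of \<open>'a\<close>, and functionals on \<open>M\<close> as functions on \<open>'a\<close>
  of which only the values on \<open>M\<close> matter.
\<close>

definition nondegenerate_on :: "'a::{ring,monoid_mult} set \<Rightarrow> ('a \<Rightarrow> 'k::field) \<Rightarrow> bool"
  where "nondegenerate_on M \<omega> \<longleftrightarrow>
    (\<forall>m\<in>M. (\<forall>n\<in>M. \<omega> (m * n) = 0) \<longrightarrow> m = 0) \<and>
    (\<forall>n\<in>M. (\<forall>m\<in>M. \<omega> (m * n) = 0) \<longrightarrow> n = 0)"

context
  fixes scale :: "'k::field \<Rightarrow> 'a::{ring,monoid_mult} \<Rightarrow> 'a" (infixr \<open>*s\<close> 75)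
begin

definition unital_subalgebra :: "'a set \<Rightarrow> bool"
  where "unital_subalgebra M \<longleftrightarrow>
    module.subspace scale M \<and> 1 \<in> M \<and> (\<forall>x\<in>M. \<forall>y\<in>M. x * y \<in> M)"

definition is_quasi_basis :: "'a set \<Rightarrow> ('a \<Rightarrow> 'k) \<Rightarrow> ('a, 'k) tensor \<Rightarrow> bool"
  where "is_quasi_basis M \<omega> q \<longleftrightarrow> q \<in> tensor_product scale M M \<and>
    (\<forall>m\<in>M. sweedler scale (\<lambda>x y. \<omega> (m * x) *s y) q = m \<and>
            sweedler scale (\<lambda>x y. \<omega> (y * m) *s x) q = m)"

definition quasi_basis :: "'a set \<Rightarrow> ('a \<Rightarrow> 'k) \<Rightarrow> ('a, 'k) tensor"
  where "quasi_basis M \<omega> = (THE q. is_quasi_basis M \<omega> q)"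

definition Ind :: "'a set \<Rightarrow> ('a \<Rightarrow> 'k) \<Rightarrow> 'a"
  where "Ind M \<omega> = sweedler scale (*) (quasi_basis M \<omega>)"

definition algebra_automorphism :: "'a set \<Rightarrow> ('a \<Rightarrow> 'a) \<Rightarrow> bool"
  where "algebra_automorphism M \<theta> \<longleftrightarrow> bij_betw \<theta> M M \<and> \<theta> 1 = 1 \<and>
    (\<forall>x\<in>M. \<forall>y\<in>M. \<theta> (x + y) = \<theta> x + \<theta> y \<and> \<theta> (x * y) = \<theta> x * \<theta> y) \<and>
    (\<forall>c. \<forall>x\<in>M. \<theta> (c *s x) = c *s \<theta> x)"

text \<open>Uniqueness is part of the notion, as an equality of maps on \<open>M\<close>.\<close>

definition is_modular_automorphism :: "'a set \<Rightarrow> ('a \<Rightarrow> 'k) \<Rightarrow> ('a \<Rightarrow> 'a) \<Rightarrow> bool"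
  where "is_modular_automorphism M \<omega> \<theta> \<longleftrightarrow>
    (algebra_automorphism M \<theta> \<and> (\<forall>x\<in>M. \<forall>y\<in>M. \<omega> (x * y) = \<omega> (y * \<theta> x))) \<and>
    (\<forall>\<theta>'. algebra_automorphism M \<theta>' \<and> (\<forall>x\<in>M. \<forall>y\<in>M. \<omega> (x * y) = \<omega> (y * \<theta>' x)) \<longrightarrow>
      (\<forall>x\<in>M. \<theta>' x = \<theta> x))"

text \<open>
  Separability: the multiplication \<open>M \<otimes> M \<rightarrow> M\<close> has a section \<open>s\<close> which is a map of \<open>M\<close>-bimodules.
\<close>

definition separable_algebra :: "'a set \<Rightarrow> bool"
  where "separable_algebra M \<longleftrightarrow> unital_subalgebra M \<and>
    (\<exists>s. (\<forall>m\<in>M. s m \<in> tensor_product scale M M \<and> sweedler scale (*) (s m) = m) \<and>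
         (\<forall>m\<in>M. \<forall>n\<in>M. s (m + n) = s m + s n) \<and>
         (\<forall>c. \<forall>m\<in>M. s (c *s m) = tensor_scale c (s m)) \<and>
         (\<forall>a\<in>M. \<forall>m\<in>M. \<forall>b\<in>M.
           s (a * m * b) = sweedler scale (\<lambda>x y. pure scale (a * x) (y * b)) (s m)))"

definition left_ideal :: "'a set \<Rightarrow> 'a set \<Rightarrow> bool"
  where "left_ideal M I \<longleftrightarrow> module.subspace scale I \<and> I \<subseteq> M \<and> (\<forall>m\<in>M. \<forall>x\<in>I. m * x \<in> I)"

definition minimal_left_ideal :: "'a set \<Rightarrow> 'a set \<Rightarrow> bool"
  where "minimal_left_ideal M I \<longleftrightarrow> left_ideal M I \<and> I \<noteq> {0} \<and>
    (\<forall>J. left_ideal M J \<and> J \<subseteq> I \<longrightarrow> J = {0} \<or> J = I)"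

text \<open>
  Semisimplicity: the left regular module is the (internal) direct sum of a finite family of simple
  submodules.  The empty family is allowed, so that the zero algebra is semisimple.
\<close>

definition semisimple_algebra :: "'a set \<Rightarrow> bool"
  where "semisimple_algebra M \<longleftrightarrow> unital_subalgebra M \<and>
    (\<exists>F. finite F \<and> (\<forall>I\<in>F. minimal_left_ideal M I) \<and>
      (\<forall>m\<in>M. \<exists>!f. f \<in> extensional F \<and> (\<forall>I\<in>F. f I \<in> I) \<and> m = (\<Sum>I\<in>F. f I)))"

end

end

theory Submission
  imports Defs
begin

text \<open>
  Write \<open>\<Delta> 1 = e\<^sub>i \<otimes> f\<^sub>i\<close>.  Comonoidality gives \<open>e\<^sub>i \<otimes> f\<^sub>i e\<^sub>j \<otimes> f\<^sub>j = \<Delta>\<^sup>2 1 = e\<^sub>i \<otimes> e\<^sub>j f\<^sub>i \<otimes> f\<^sub>j\<close>.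
  The counit in the middle factor shows that the four maps \<open>S\<close>, extended to all of \<open>A\<close> by their
  defining formulas, restrict to the identity on the subalgebra in which they take their values
  (so \<open>S\<^sub>L\<close> is the identity on \<open>A\<^sub>R\<close>); in particular one may choose \<open>e\<^sub>i \<in> A\<^sub>R\<close>, \<open>f\<^sub>i \<in> A\<^sub>L\<close>.  Monoidality at the unit,
  \<open>\<epsilon> (a c) = \<epsilon> (a e\<^sub>i) \<epsilon> (f\<^sub>i c) = \<epsilon> (a f\<^sub>i) \<epsilon> (e\<^sub>i c)\<close>, then says
  \<open>\<epsilon> (a S\<^sub>R(b)) = \<epsilon> (a b) = \<epsilon> (S\<^sub>L(a) b)\<close>, from which the quasi-bases and the modular automorphisms
  are read off; the index is 1 because \<open>\<Delta> 1\<close> is idempotent.  A quasi-basis \<open>x\<^sub>i \<otimes> y\<^sub>i\<close> is a Casimir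
  element, so index 1 makes it a separability idempotent, and averaging linear projections with it
  makes every left ideal a direct summand.
\<close>

section \<open>Bilinear maps and tensors\<close>

lemma vector_space_mult: "vector_space ((*) :: 'k::field \<Rightarrow> 'k \<Rightarrow> 'k)"
  by unfold_locales (simp_all add: algebra_simps)

lemma vector_space_tensor_scale: "vector_space (tensor_scale :: 'k::field \<Rightarrow> ('b \<Rightarrow> 'k) \<Rightarrow> _)"
  by unfold_locales (auto simp: tensor_scale_def fun_eq_iff algebra_simps)

lemma linear_eval: "Vector_Spaces.linear tensor_scale (*) (\<lambda>t. t \<beta>)"
  by (auto simp: Vector_Spaces.linear_iff vector_space_mult vector_space_tensor_scale tensor_scale_def)

lemma linear_functionalD:
  assumes "Vector_Spaces.linear s (*) \<phi>"
  shows "\<phi> (x + y) = \<phi> x + \<phi> y" "\<phi> (x - y) = \<phi> x - \<phi> y" "\<phi> (s c x) = c * \<phi> x"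
    "\<phi> (\<Sum>i\<in>I. z i) = (\<Sum>i\<in>I. \<phi> (z i))"
proof -
  interpret Vector_Spaces.linear s "(*)" \<phi> by fact
  show "\<phi> (x + y) = \<phi> x + \<phi> y" "\<phi> (x - y) = \<phi> x - \<phi> y" "\<phi> (s c x) = c * \<phi> x"
    "\<phi> (\<Sum>i\<in>I. z i) = (\<Sum>i\<in>I. \<phi> (z i))"
    by (fact add diff scale sum)+
qed

lemma linear_sum_scale:
  assumes "Vector_Spaces.linear s t f"
  shows "f (\<Sum>i\<in>I. s (c i) (x i)) = (\<Sum>i\<in>I. t (c i) (f (x i)))"
proof -
  interpret Vector_Spaces.linear s t f by fact
  show ?thesis by (simp add: sum scale)
qed

lemma bilinear_map_linear_left: "bilinear_map s t g \<Longrightarrow> Vector_Spaces.linear s t (\<lambda>x. g x y)"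
  and bilinear_map_linear_right: "bilinear_map s t g \<Longrightarrow> Vector_Spaces.linear s t (g x)"
  by (simp_all add: bilinear_map_def)

lemma bilinear_map_iff:
  "bilinear_map s t g \<longleftrightarrow> vector_space s \<and> vector_space t \<and>
    (\<forall>x x' y. g (x + x') y = g x y + g x' y) \<and> (\<forall>c x y. g (s c x) y = t c (g x y)) \<and>
    (\<forall>x y y'. g x (y + y') = g x y + g x y') \<and> (\<forall>c x y. g x (s c y) = t c (g x y))"
  by (auto simp: bilinear_map_def Vector_Spaces.linear_iff)

lemma trilinear_map_iff:
  "trilinear_map s t g \<longleftrightarrow> vector_space s \<and> vector_space t \<and>
    (\<forall>x x' y z. g (x + x') y z = g x y z + g x' y z) \<and> (\<forall>c x y z. g (s c x) y z = t c (g x y z)) \<and>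
    (\<forall>x y y' z. g x (y + y') z = g x y z + g x y' z) \<and> (\<forall>c x y z. g x (s c y) z = t c (g x y z)) \<and>
    (\<forall>x y z z'. g x y (z + z') = g x y z + g x y z') \<and> (\<forall>c x y z. g x y (s c z) = t c (g x y z))"
  by (auto simp: trilinear_map_def Vector_Spaces.linear_iff)

lemma bilinear_map_sum:
  assumes "vector_space s" "vector_space t" "\<And>i. i \<in> I \<Longrightarrow> bilinear_map s t (g i)"
  shows "bilinear_map s t (\<lambda>x y. \<Sum>i\<in>I. g i x y)"
proof -
  interpret T: vector_space t by fact
  show ?thesis
    using assms by (simp add: bilinear_map_iff sum.distrib T.scale_sum_right)
qed

section \<open>Evaluating and comparing tensors on bilinear forms\<close>

lemma pure_apply: "bilinear_map scale (*) \<beta> \<Longrightarrow> pure scale x y \<beta> = \<beta> x y"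
  by (simp add: pure_def)

lemma pure3_apply: "trilinear_map scale (*) \<tau> \<Longrightarrow> pure3 scale x y z \<tau> = \<tau> x y z"
  by (simp add: pure3_def)

lemma sum_pure_apply:
  "bilinear_map scale (*) \<beta> \<Longrightarrow> (\<Sum>i\<in>I. pure scale (x i) (y i)) \<beta> = (\<Sum>i\<in>I. \<beta> (x i) (y i))"
  by (simp add: sum_fun_app pure_apply)

text \<open>Sums of pure tensors take the value 0 outside the bilinear forms, so two of them agree
  as soon as they agree on bilinear forms.\<close>

lemma sum_pure_eqI:
  assumes "\<And>\<beta>. bilinear_map scale (*) \<beta> \<Longrightarrow>
    (\<Sum>i\<in>I. \<beta> (x i) (y i)) = (\<Sum>j\<in>J. \<beta> (u j) (v j))"
  shows "(\<Sum>i\<in>I. pure scale (x i) (y i)) = (\<Sum>j\<in>J. pure scale (u j) (v j))"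
proof
  fix \<beta>
  show "(\<Sum>i\<in>I. pure scale (x i) (y i)) \<beta> = (\<Sum>j\<in>J. pure scale (u j) (v j)) \<beta>"
    using assms[of \<beta>] by (cases "bilinear_map scale (*) \<beta>") (auto simp: sum_fun_app pure_def)
qed

lemma sum_pure_in_tensor_product:
  fixes n :: nat
  assumes "\<And>i. i < n \<Longrightarrow> x i \<in> M" "\<And>i. i < n \<Longrightarrow> y i \<in> N"
  shows "(\<Sum>i<n. pure scale (x i) (y i)) \<in> tensor_product scale M N"
  using assms unfolding tensor_product_def by blast

lemma tensor_productE:
  assumes "t \<in> tensor_product scale M N"
  obtains n :: nat and x y where "\<And>i. i < n \<Longrightarrow> x i \<in> M" "\<And>i. i < n \<Longrightarrow> y i \<in> N"
    "t = (\<Sum>i<n. pure scale (x i) (y i))"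
  using assms unfolding tensor_product_def by blast

text \<open>A tensor is itself a functional on bilinear forms, so testing a Sweedler sum with \<phi>
  means evaluating \<open>t\<close> at the composite of \<phi> and \<open>f\<close>. Together with
  \<open>linear_eq_iff_functionals\<close> this trades the definite description in
  \<open>sweedler\<close> for identities of scalars.\<close>

lemma linear_sweedler:
  assumes t: "t \<in> tensor_product scale M N" and f: "bilinear_map scale s f"
    and \<phi>: "Vector_Spaces.linear s (*) \<phi>"
  shows "\<phi> (sweedler scale f t) = t (\<lambda>x y. \<phi> (f x y))"
proof -
  have V: "vector_space s"
    using f by (simp add: bilinear_map_iff)
  note \<phi>_simps = linear_functionalD[OF \<phi>]
  obtain n :: nat and x y where t_eq: "t = (\<Sum>i<n. pure scale (x i) (y i))"
    using t by (auto elim: tensor_productE)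
  have "bilinear_map scale (*) (\<lambda>x y. \<phi> (f x y))"
    using f vector_space_mult by (simp add: bilinear_map_iff \<phi>_simps)
  with f show ?thesis
    unfolding t_eq by (simp add: sweedler_sum_pure[OF V] \<phi>_simps sum_pure_apply)
qed

lemma linear_eq_iff_functionals:
  assumes "vector_space s"
  shows "x = y \<longleftrightarrow> (\<forall>\<phi>. Vector_Spaces.linear s (*) \<phi> \<longrightarrow> \<phi> x = \<phi> y)"
proof
  assume eq: "\<forall>\<phi>. Vector_Spaces.linear s (*) \<phi> \<longrightarrow> \<phi> x = \<phi> y"
  show "x = y"
  proof (rule ccontr)
    assume "x \<noteq> y"
    then obtain \<phi> where \<phi>: "Vector_Spaces.linear s (*) \<phi>" and ne: "\<phi> (x - y) \<noteq> 0"
      using linear_functional_separates[OF assms, of "x - y"] by auto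
    note \<phi>_simps = linear_functionalD[OF \<phi>]
    show False using ne eq \<phi> by (simp add: \<phi>_simps)
  qed
qed simp

context fin_dim_algebra
begin

lemma bilinear_map_pure: "bilinear_map scale tensor_scale (pure scale)"
  using vector_space_axioms vector_space_tensor_scale
  by (auto simp: bilinear_map_iff pure_def fun_eq_iff tensor_scale_def)

lemma trilinear_map_pure3: "trilinear_map scale tensor_scale (pure3 scale)"
  using vector_space_axioms vector_space_tensor_scale
  by (auto simp: trilinear_map_iff pure3_def fun_eq_iff tensor_scale_def)

lemma bilinear_map_mult: "bilinear_map scale scale (*)"
  using vector_space_axioms
  by (auto simp: bilinear_map_iff scale_mult_left scale_mult_right algebra_simps)

lemma linear_functional_mult:
  assumes "Vector_Spaces.linear scale (*) \<phi>"
  shows "Vector_Spaces.linear scale (*) (\<lambda>x. \<phi> (m * x))" "Vector_Spaces.linear scale (*) (\<lambda>x. \<phi> (x * m))"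
  using assms
  by (simp_all add: Vector_Spaces.linear_iff distrib_left distrib_right scale_mult_left scale_mult_right)

lemma bilinear_map_functional_scale:
  assumes "Vector_Spaces.linear scale (*) \<phi>"
  shows "bilinear_map scale scale (\<lambda>x y. \<phi> x *s y)" "bilinear_map scale scale (\<lambda>x y. \<phi> y *s x)"
  using assms vector_space_axioms
  by (simp_all add: bilinear_map_iff Vector_Spaces.linear_iff scale_left_distrib scale_right_distrib mult.commute)

lemma bilinear_map_linear_comp:
  assumes "bilinear_map scale t g" "Vector_Spaces.linear scale scale S"
  shows "bilinear_map scale t (\<lambda>x y. g (S x) y)" "bilinear_map scale t (\<lambda>x y. g x (S y))"
  using assms by (simp_all add: bilinear_map_iff Vector_Spaces.linear_iff)

end


section \<open>Functionals with a quasi-basis\<close>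

text \<open>The quasi-basis enters as a concrete family x_i, y_i instead of a tensor, so that all
  consequences are computations with finite sums; the last two assumptions are its two defining
  identities.\<close>

locale functional_with_quasi_basis = fin_dim_algebra scale
  for scale :: "'k::field \<Rightarrow> 'a::{ring,monoid_mult} \<Rightarrow> 'a" (infixr \<open>*s\<close> 75) +
  fixes M :: "'a set" and \<omega> :: "'a \<Rightarrow> 'k" and n :: nat and x y :: "nat \<Rightarrow> 'a"
  assumes unital_subalgebra: "unital_subalgebra scale M"
    and functional_linear: "Vector_Spaces.linear scale (*) \<omega>"
    and x_in: "i < n \<Longrightarrow> x i \<in> M" and y_in: "i < n \<Longrightarrow> y i \<in> M"
    and expand_y: "m \<in> M \<Longrightarrow> (\<Sum>i<n. \<omega> (m * x i) *s y i) = m"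
    and expand_x: "m \<in> M \<Longrightarrow> (\<Sum>i<n. \<omega> (y i * m) *s x i) = m"
begin

lemmas functional_simps = linear_functionalD[OF functional_linear]

lemma subspace_M: "subspace M" and one_in: "1 \<in> M"
  and mult_in: "a \<in> M \<Longrightarrow> b \<in> M \<Longrightarrow> a * b \<in> M"
  using unital_subalgebra by (auto simp: unital_subalgebra_def)

text \<open>The two expansions have coefficients \<omega>(m x_i) and \<omega>(y_i m), which all
  vanish if m is orthogonal to \<open>M\<close> on the right or on the left.\<close>

lemma nondegenerate: "nondegenerate_on M \<omega>"
  unfolding nondegenerate_on_def
proof (intro conjI ballI impI)
  fix m assume "m \<in> M" "\<forall>a\<in>M. \<omega> (m * a) = 0"
  then show "m = 0" using expand_y[of m] x_in by simp
next
  fix m assume "m \<in> M" "\<forall>a\<in>M. \<omega> (a * m) = 0"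
  then show "m = 0" using expand_x[of m] y_in by simp
qed

lemma eqI_left:
  assumes "a \<in> M" "b \<in> M" "\<And>m. m \<in> M \<Longrightarrow> \<omega> (m * a) = \<omega> (m * b)"
  shows "a = b"
proof -
  have "a - b \<in> M" using assms subspace_M subspace_diff by blast
  moreover have "\<omega> (m * (a - b)) = 0" if "m \<in> M" for m
    using assms(3)[OF that] by (simp add: right_diff_distrib functional_simps)
  ultimately show ?thesis
    using nondegenerate unfolding nondegenerate_on_def by fastforce
qed

lemma eqI_right:
  assumes "a \<in> M" "b \<in> M" "\<And>m. m \<in> M \<Longrightarrow> \<omega> (a * m) = \<omega> (b * m)"
  shows "a = b"
proof -
  have "a - b \<in> M" using assms subspace_M subspace_diff by blast
  moreover have "\<omega> ((a - b) * m) = 0" if "m \<in> M" for m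
    using assms(3)[OF that] by (simp add: left_diff_distrib functional_simps)
  ultimately show ?thesis
    using nondegenerate unfolding nondegenerate_on_def by fastforce
qed

section \<open>Uniqueness of the quasi-basis, its index and the Casimir property\<close>

abbreviation quasi_basis_sum :: "('a, 'k) tensor"
  where "quasi_basis_sum \<equiv> \<Sum>i<n. pure scale (x i) (y i)"

lemmas sweedler_functional =
  bilinear_map_functional_scale(1)[OF linear_functional_mult(1)[OF functional_linear],
    THEN sweedler_sum_pure[OF vector_space_axioms]]
  bilinear_map_functional_scale(2)[OF linear_functional_mult(2)[OF functional_linear],
    THEN sweedler_sum_pure[OF vector_space_axioms]]

lemma is_quasi_basis_sum: "is_quasi_basis scale M \<omega> quasi_basis_sum"
  unfolding is_quasi_basis_def
  using sum_pure_in_tensor_product[of n x M y M] x_in y_in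
  by (simp add: sweedler_functional expand_x expand_y)

text \<open>For a second quasi-basis u_j \<otimes> v_j, the sum of \<omega>(v_j x_i) u_j \<otimes>
  y_i over i and j collapses to u_j \<otimes> v_j when summed over i first, and to x_i \<otimes> y_i
  when summed over j first.\<close>

lemma is_quasi_basis_unique:
  assumes "is_quasi_basis scale M \<omega> q"
  shows "q = quasi_basis_sum"
proof -
  have "q \<in> tensor_product scale M M"
    using assms by (simp add: is_quasi_basis_def)
  then obtain k :: nat and u v where uv: "\<And>j. j < k \<Longrightarrow> v j \<in> M"
    and q: "q = (\<Sum>j<k. pure scale (u j) (v j))"
    by (rule tensor_productE) blast
  have expand_u: "(\<Sum>j<k. \<omega> (v j * m) *s u j) = m" if "m \<in> M" for m
    using assms that unfolding is_quasi_basis_def q by (simp add: sweedler_functional)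
  show ?thesis
    unfolding q
  proof (rule sum_pure_eqI)
    fix \<beta> :: "'a \<Rightarrow> 'a \<Rightarrow> 'k"
    assume \<beta>: "bilinear_map scale (*) \<beta>"
    note left = linear_sum_scale[OF bilinear_map_linear_left[OF \<beta>]]
      and right = linear_sum_scale[OF bilinear_map_linear_right[OF \<beta>]]
    have "(\<Sum>j<k. \<beta> (u j) (v j)) = (\<Sum>j<k. \<beta> (u j) (\<Sum>i<n. \<omega> (v j * x i) *s y i))"
      by (intro sum.cong refl) (simp add: expand_y uv)
    also have "\<dots> = (\<Sum>i<n. \<Sum>j<k. \<omega> (v j * x i) * \<beta> (u j) (y i))"
      unfolding right by (rule sum.swap)
    also have "\<dots> = (\<Sum>i<n. \<beta> (\<Sum>j<k. \<omega> (v j * x i) *s u j) (y i))"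
      unfolding left ..
    also have "\<dots> = (\<Sum>i<n. \<beta> (x i) (y i))"
      by (intro sum.cong refl) (simp add: expand_u x_in)
    finally show "(\<Sum>j<k. \<beta> (u j) (v j)) = (\<Sum>i<n. \<beta> (x i) (y i))" .
  qed
qed

lemma ex1_quasi_basis: "\<exists>!q. is_quasi_basis scale M \<omega> q"
  using is_quasi_basis_sum is_quasi_basis_unique by blast

lemma quasi_basis_eq: "quasi_basis scale M \<omega> = quasi_basis_sum"
  unfolding quasi_basis_def using is_quasi_basis_sum is_quasi_basis_unique by blast

lemma Ind_eq: "Ind scale M \<omega> = (\<Sum>i<n. x i * y i)"
  unfolding Ind_def quasi_basis_eq
  by (rule sweedler_sum_pure[OF vector_space_axioms bilinear_map_mult])

text \<open>Expand m x_i in the family \<open>x\<close>, carry the scalar coefficients to the second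
  argument, and recognize there the expansion of y_j m in the family \<open>y\<close>. A general
  bilinear \<open>g\<close> serves both the separability section and the averaged
  projection.\<close>

lemma casimir:
  assumes g: "bilinear_map scale s g" and m: "m \<in> M"
  shows "(\<Sum>i<n. g (m * x i) (y i)) = (\<Sum>i<n. g (x i) (y i * m))"
proof -
  note left = linear_sum_scale[OF bilinear_map_linear_left[OF g]]
    and right = linear_sum_scale[OF bilinear_map_linear_right[OF g]]
  have "(\<Sum>i<n. g (m * x i) (y i)) = (\<Sum>i<n. g (\<Sum>j<n. \<omega> (y j * (m * x i)) *s x j) (y i))"
    by (intro sum.cong refl) (simp add: expand_x mult_in x_in m)
  also have "\<dots> = (\<Sum>j<n. \<Sum>i<n. s (\<omega> (y j * (m * x i))) (g (x j) (y i)))"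
    unfolding left by (rule sum.swap)
  also have "\<dots> = (\<Sum>j<n. g (x j) (\<Sum>i<n. \<omega> (y j * m * x i) *s y i))"
    unfolding right by (simp add: mult.assoc)
  also have "\<dots> = (\<Sum>j<n. g (x j) (y j * m))"
    by (intro sum.cong refl) (simp add: expand_y mult_in y_in m)
  finally show ?thesis .
qed

text \<open>The modular identity alone forces everything else: injectivity, multiplicativity,
  linearity, the value at 1 and uniqueness all follow by cancelling in the nondegenerate form, and
  surjectivity follows from the quasi-basis.\<close>

lemma is_modular_automorphismI:
  assumes in_M: "\<And>a. a \<in> M \<Longrightarrow> \<theta> a \<in> M"
    and modular: "\<And>a b. a \<in> M \<Longrightarrow> b \<in> M \<Longrightarrow> \<omega> (a * b) = \<omega> (b * \<theta> a)"
  shows "is_modular_automorphism scale M \<omega> \<theta>"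
proof -
  note in_M = in_M mult_in subspace_add[OF subspace_M] subspace_scale[OF subspace_M] one_in
  have inj: "inj_on \<theta> M"
    by (intro inj_onI eqI_right) (simp_all add: modular)
  have surj: "z \<in> \<theta> ` M" if z: "z \<in> M" for z
  proof
    \<comment> \<open>The preimage w is chosen so that \<omega>(w m) = \<omega>(m z): the form
      \<omega>(x_i z) \<omega>(y_i m) of the left side contains the expansion of m in the family
      \<open>x\<close>.\<close>
    let ?w = "\<Sum>i<n. \<omega> (x i * z) *s y i"
    show w: "?w \<in> M"
      by (intro subspace_sum[OF subspace_M]) (simp add: in_M y_in)
    show "z = \<theta> ?w"
    proof (rule eqI_left)
      fix m assume m: "m \<in> M"
      have "\<omega> (m * \<theta> ?w) = \<omega> (?w * m)"
        by (simp add: modular w m)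
      also have "\<dots> = (\<Sum>i<n. \<omega> (x i * z) * \<omega> (y i * m))"
        by (simp add: sum_distrib_right scale_mult_left functional_simps)
      also have "\<dots> = \<omega> ((\<Sum>i<n. \<omega> (y i * m) *s x i) * z)"
        by (simp add: sum_distrib_right scale_mult_left functional_simps mult.commute)
      also have "\<dots> = \<omega> (m * z)"
        by (simp add: expand_x m)
      finally show "\<omega> (m * z) = \<omega> (m * \<theta> ?w)" ..
    qed (fact z, rule in_M, fact w)
  qed
  have mult: "\<theta> (a * b) = \<theta> a * \<theta> b" if "a \<in> M" "b \<in> M" for a b
  proof (rule eqI_left)
    fix m assume "m \<in> M"
    \<comment> \<open>Rotating one factor at a time: \<omega>(m \<theta>(ab)) = \<omega>(a b m) =
      \<omega>(b m \<theta>(a)) = \<omega>(m \<theta>(a) \<theta>(b)).\<close>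
    with that show "\<omega> (m * \<theta> (a * b)) = \<omega> (m * (\<theta> a * \<theta> b))"
      using modular[of "a * b" m] modular[of a "b * m"] modular[of b "m * \<theta> a"]
      by (simp add: in_M mult.assoc)
  qed (simp_all add: in_M that)
  have add: "\<theta> (a + b) = \<theta> a + \<theta> b" if "a \<in> M" "b \<in> M" for a b
    using that
    by (intro eqI_left) (simp_all add: in_M distrib_left functional_simps distrib_right flip: modular)
  have scale: "\<theta> (c *s a) = c *s \<theta> a" if "a \<in> M" for a c
    using that
    by (intro eqI_left) (simp_all add: in_M scale_mult_left scale_mult_right functional_simps flip: modular)
  have one: "\<theta> 1 = 1"
    by (intro eqI_left) (simp_all add: in_M flip: modular)
  have unique: "\<theta>' a = \<theta> a"
    if "algebra_automorphism scale M \<theta>'" and "\<forall>a\<in>M. \<forall>b\<in>M. \<omega> (a * b) = \<omega> (b * \<theta>' a)"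
      and a: "a \<in> M" for \<theta>' a
  proof (rule eqI_left)
    show "\<theta>' a \<in> M"
      using that unfolding algebra_automorphism_def by (auto dest: bij_betwE)
    fix m assume "m \<in> M"
    then have "\<omega> (a * m) = \<omega> (m * \<theta>' a)" using that(2) a by blast
    with \<open>m \<in> M\<close> show "\<omega> (m * \<theta>' a) = \<omega> (m * \<theta> a)"
      using modular[of a m] a by argo
  qed (simp add: in_M a)
  have "\<theta> ` M = M"
    using surj in_M(1) by blast
  then have "algebra_automorphism scale M \<theta>"
    using inj mult add scale one by (simp add: algebra_automorphism_def bij_betw_def)
  then show ?thesis
    unfolding is_modular_automorphism_def using unique modular by blast
qed

end


section \<open>Functionals of index one\<close>

locale functional_of_index_one = functional_with_quasi_basis scale M \<omega> n x y
  for scale :: "'k::field \<Rightarrow> 'a::{ring,monoid_mult} \<Rightarrow> 'a" (infixr \<open>*s\<close> 75) and M \<omega> n x y +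
  assumes index_one: "(\<Sum>i<n. x i * y i) = 1"
begin

text \<open>The section is m \<mapsto> m x_i \<otimes> y_i. Compatibility with the left action is
  visible, with the right action it is the Casimir property, and index one makes it a section of the
  multiplication.\<close>

lemma separable: "separable_algebra scale M"
proof -
  define s where "s m = (\<Sum>i<n. pure scale (m * x i) (y i))" for m
  interpret T: vector_space "tensor_scale :: 'k \<Rightarrow> ('a, 'k) tensor \<Rightarrow> _"
    by (rule vector_space_tensor_scale)
  note pure = bilinear_map_pure[unfolded bilinear_map_iff]
  have section': "sweedler scale (*) (s m) = m" for m
    unfolding s_def sweedler_sum_pure[OF vector_space_axioms bilinear_map_mult]
    by (simp add: mult.assoc index_one flip: sum_distrib_left)
  have bimodule: "s (a * m * b) = sweedler scale (\<lambda>u v. pure scale (a * u) (v * b)) (s m)"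
    if b: "b \<in> M" for a m b
  proof -
    have "bilinear_map scale tensor_scale (\<lambda>u v. pure scale (a * u) (v * b))"
      using pure by (simp add: bilinear_map_iff distrib_left distrib_right scale_mult_left scale_mult_right)
    then have "sweedler scale (\<lambda>u v. pure scale (a * u) (v * b)) (s m) =
        (\<Sum>i<n. pure scale (a * (m * x i)) (y i * b))"
      unfolding s_def by (rule sweedler_sum_pure[OF T.vector_space_axioms])
    also have "\<dots> = (\<Sum>i<n. pure scale (a * (m * (b * x i))) (y i))"
    proof (rule casimir[symmetric, OF _ b])
      show "bilinear_map scale tensor_scale (\<lambda>u v. pure scale (a * (m * u)) v)"
        using pure by (simp add: bilinear_map_iff distrib_left scale_mult_right)
    qed
    finally show ?thesis
      by (simp add: s_def mult.assoc)
  qed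
  show ?thesis
    unfolding separable_algebra_def
  proof (intro conjI exI[of _ s] ballI allI)
    show "s m \<in> tensor_product scale M M" if "m \<in> M" for m
      unfolding s_def using that by (intro sum_pure_in_tensor_product mult_in x_in y_in)
    show "s (a + b) = s a + s b" for a b
      using pure by (simp add: s_def distrib_right sum.distrib)
    show "s (c *s a) = tensor_scale c (s a)" for c a
      using pure by (simp add: s_def scale_mult_left T.scale_sum_right)
    show "unital_subalgebra scale M" by (fact unital_subalgebra)
    show "sweedler scale (*) (s m) = m" for m by (fact section')
    show "s (a * m * b) = sweedler scale (\<lambda>x y. pure scale (a * x) (y * b)) (s m)" if "b \<in> M" for a m b
      using that by (fact bimodule)
  qed
qed

text \<open>
  Maschke's averaging argument: a linear projection \<open>p\<close> onto a left ideal becomes \<open>M\<close>-linear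
  when it is replaced by \<open>m \<mapsto> x\<^sub>i * p (y\<^sub>i * m)\<close>.
\<close>

lemma left_ideal_projection:
  assumes I: "left_ideal scale M I"
  obtains P where "Vector_Spaces.linear scale scale P" "\<And>m. P m \<in> I" "\<And>m. m \<in> I \<Longrightarrow> P m = m"
    "\<And>a m. a \<in> M \<Longrightarrow> P (a * m) = a * P m"
proof -
  interpret VV: vector_space_pair scale scale ..
  have sub: "subspace I" and I_mult: "\<And>a m. a \<in> M \<Longrightarrow> m \<in> I \<Longrightarrow> a * m \<in> I"
    using I by (auto simp: left_ideal_def)
  \<comment> \<open>A linear left inverse of the inclusion of \<open>I\<close> is a linear
    projection onto \<open>I\<close>.\<close>
  obtain p where p: "range p \<subseteq> I" "Vector_Spaces.linear scale scale p" "\<forall>m\<in>I. p m = m"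
    using VV.linear_exists_left_inverse_on[OF linear_ident sub] by auto
  interpret p: Vector_Spaces.linear scale scale p by fact
  define P where "P m = (\<Sum>i<n. x i * p (y i * m))" for m
  show ?thesis
  proof
    show "Vector_Spaces.linear scale scale P"
      using vector_space_axioms
      by (auto simp: Vector_Spaces.linear_iff P_def distrib_left p.add sum.distrib
          scale_mult_right p.scale scale_sum_right)
    show "P m \<in> I" for m
      unfolding P_def using p(1) by (intro subspace_sum[OF sub] I_mult) (auto simp: x_in)
    show "P m = m" if "m \<in> I" for m
    proof -
      have "P m = (\<Sum>i<n. x i * (y i * m))"
        unfolding P_def using that p(3) by (intro sum.cong refl) (simp add: I_mult y_in)
      also have "\<dots> = m"
        by (simp add: index_one flip: sum_distrib_right mult.assoc)
      finally show ?thesis .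
    qed
    show "P (a * m) = a * P m" if a: "a \<in> M" for a m
    proof -
      \<comment> \<open>For this bilinear map the Casimir property reads a x_i p(y_i m) = x_i p(y_i
        a m).\<close>
      have "bilinear_map scale scale (\<lambda>u v. u * p (v * m))"
        using vector_space_axioms
        by (simp add: bilinear_map_iff distrib_left distrib_right p.add p.scale scale_mult_left scale_mult_right)
      from casimir[OF this a] show ?thesis
        by (simp add: P_def sum_distrib_left mult.assoc)
    qed
  qed
qed

text \<open>Induction on the dimension: a minimal left ideal \<open>J\<close> inside
  \<open>I\<close> is split off, and the kernel of an \<open>M\<close>-linear projection onto
  \<open>J\<close> supplies a complementary left ideal of smaller dimension.\<close>

lemma left_ideal_decomposition:
  assumes "left_ideal scale M I"
  shows "\<exists>F. finite F \<and> (\<forall>J\<in>F. minimal_left_ideal scale M J \<and> J \<subseteq> I) \<and>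
    (\<forall>m\<in>I. \<exists>!f. f \<in> extensional F \<and> (\<forall>J\<in>F. f J \<in> J) \<and> m = (\<Sum>J\<in>F. f J))"
proof -
  \<comment> \<open>A finite basis makes \<open>dim\<close> strictly monotone on subspaces, which
    drives both the induction and the choice of \<open>J\<close>.\<close>
  obtain S where "finite S" "span S = UNIV"
    using finite_dimensional by auto
  then obtain B where B: "B \<subseteq> S" "independent B" "S \<subseteq> span B"
    using maximal_independent_subset by blast
  have "span B = UNIV"
    using B(3) \<open>span S = UNIV\<close> span_minimal[OF B(3) subspace_span] by auto
  with B interpret fd: finite_dimensional_vector_space scale B
    using \<open>finite S\<close> by unfold_locales (auto intro: finite_subset)
  have dim_less: "dim J < dim I" if "subspace J" "subspace I" "J \<subset> I" for I J
    using that fd.dim_psubset[of J I] by (simp add: span_eq_iff[THEN iffD2])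
  show ?thesis
    using assms
  proof (induction "dim I" arbitrary: I rule: less_induct)
    case less
    show ?case
    proof (cases "I = {0}")
      case True
      then show ?thesis by (intro exI[of _ "{}"]) auto
    next
      case False
      define Q where "Q J \<longleftrightarrow> left_ideal scale M J \<and> J \<subseteq> I \<and> J \<noteq> {0}" for J
      \<comment> \<open>A nonzero left ideal of least dimension is minimal, since a proper nonzero
        left ideal inside it would have smaller dimension.\<close>
      define J where "J = arg_min dim Q"
      have "Q I" using less.prems False by (simp add: Q_def)
      then have J: "left_ideal scale M J \<and> J \<subseteq> I \<and> J \<noteq> {0}"
        unfolding J_def Q_def[symmetric] by (rule arg_min_natI)
      have J_min: "dim J \<le> dim J'" if "left_ideal scale M J'" "J' \<subseteq> I" "J' \<noteq> {0}" for J'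
      proof -
        have "Q J'" using that by (simp add: Q_def)
        then show ?thesis unfolding J_def by (rule arg_min_nat_le)
      qed
      have "minimal_left_ideal scale M J"
        unfolding minimal_left_ideal_def
        using J J_min dim_less by (metis left_ideal_def order_trans psubsetI leD)
      obtain P where P: "Vector_Spaces.linear scale scale P" "\<And>m. P m \<in> J"
          "\<And>m. m \<in> J \<Longrightarrow> P m = m" "\<And>a m. a \<in> M \<Longrightarrow> P (a * m) = a * P m"
        using left_ideal_projection J by blast
      interpret P: Vector_Spaces.linear scale scale P by fact
      define K where "K = {m \<in> I. P m = 0}"
      have sub: "subspace I" "subspace J" using less.prems J by (auto simp: left_ideal_def)
      have I_mult: "\<And>a m. a \<in> M \<Longrightarrow> m \<in> I \<Longrightarrow> a * m \<in> I" and "I \<subseteq> M"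
        using less.prems by (auto simp: left_ideal_def)
      have K: "left_ideal scale M K"
        unfolding left_ideal_def K_def
        using sub(1) I_mult \<open>I \<subseteq> M\<close> by (auto simp: subspace_def P.zero P.add P.scale P(4))
      have JK: "m = 0" if "m \<in> J" "m \<in> K" for m
        using that P(3) by (auto simp: K_def)
      obtain z where "z \<in> J" "z \<noteq> 0"
        using J sub(2) subspace_0 by blast
      then have "K \<subset> I"
        using J JK by (auto simp: K_def)
      moreover have subK: "subspace K" using K by (simp add: left_ideal_def)
      ultimately have "dim K < dim I"
        using dim_less sub(1) by blast
      from less.hyps[OF this K] obtain F
        where F: "finite F" "\<forall>J\<in>F. minimal_left_ideal scale M J \<and> J \<subseteq> K"
          and dec: "\<forall>m\<in>K. \<exists>!f. f \<in> extensional F \<and> (\<forall>J\<in>F. f J \<in> J) \<and> m = (\<Sum>J\<in>F. f J)"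
        by (elim exE conjE)
      \<comment> \<open>The family is a set of ideals, so \<open>J\<close> has to be a new member
        before it can carry a component of its own.\<close>
      have "J \<notin> F"
      proof
        assume "J \<in> F"
        with F(2) \<open>z \<in> J\<close> have "z \<in> K" by auto
        with JK \<open>z \<in> J\<close> \<open>z \<noteq> 0\<close> show False by simp
      qed
      have dec_I: "\<exists>!f. f \<in> extensional (insert J F) \<and> (\<forall>J\<in>insert J F. f J \<in> J) \<and> m = (\<Sum>J\<in>insert J F. f J)"
        if m: "m \<in> I" for m
      proof -
        define D where "D f \<longleftrightarrow> f \<in> extensional (insert J F) \<and> (\<forall>J\<in>insert J F. f J \<in> J) \<and>
          m = (\<Sum>J\<in>insert J F. f J)" for f
        \<comment> \<open>The components outside \<open>J\<close> lie in \<open>K\<close>, where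
          \<open>P\<close> vanishes; thus \<open>P\<close> reads off the \<open>J\<close>-component,
          which settles its uniqueness.\<close>
        have split: "P (\<Sum>J\<in>insert J F. g J) = g J"
          if "\<forall>J\<in>insert J F. g J \<in> J" for g
        proof -
          have "(\<Sum>J\<in>F. g J) \<in> K"
            using F(2) that by (intro subspace_sum subK) auto
          then show ?thesis
            using that \<open>J \<notin> F\<close> F(1) by (simp add: P.add P(3) K_def)
        qed
        have "m - P m \<in> K"
          using m P(2)[of m] J sub(1) by (auto simp: K_def P.diff P(3) intro!: subspace_diff)
        from bspec[OF dec this] obtain f
          where f: "f \<in> extensional F" "\<forall>J\<in>F. f J \<in> J" "m - P m = (\<Sum>J\<in>F. f J)"
            and f_unique: "\<And>g. g \<in> extensional F \<Longrightarrow> \<forall>J\<in>F. g J \<in> J \<Longrightarrow>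
              m - P m = (\<Sum>J\<in>F. g J) \<Longrightarrow> g = f"
          by metis
        \<comment> \<open>The components of m are P m in \<open>J\<close> together with those of m -
          P m in \<open>K\<close>.\<close>
        have "(\<Sum>J'\<in>F. (f(J := P m)) J') = m - P m"
          unfolding f(3) using \<open>J \<notin> F\<close> by (intro sum.cong) auto
        then have "m = (\<Sum>J'\<in>insert J F. (f(J := P m)) J')"
          by (simp only: sum.insert[OF F(1) \<open>J \<notin> F\<close>] fun_upd_same) simp
        then have "D (f(J := P m))"
          using f(1,2) P(2) unfolding D_def extensional_def by simp
        moreover have "g = f(J := P m)" if "D g" for g
        proof -
          have g: "g \<in> extensional (insert J F)" "\<forall>J\<in>insert J F. g J \<in> J"
            and m_eq: "m = (\<Sum>J\<in>insert J F. g J)"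
            using that unfolding D_def by blast+
          have gJ: "P m = g J"
            using split[OF g(2)] m_eq by simp
          have "restrict g F = f"
          proof (rule f_unique)
            show "m - P m = (\<Sum>J\<in>F. restrict g F J)"
              unfolding gJ by (simp add: m_eq F(1) \<open>J \<notin> F\<close>)
          qed (use g(2) in simp_all)
          then have "f J' = restrict g F J'" for J' by simp
          then show ?thesis
            using g(1) gJ by (intro ext) (simp add: extensional_def restrict_def)
        qed
        ultimately have "\<exists>!f. D f" by (rule ex1I)
        then show ?thesis unfolding D_def .
      qed
      have "\<forall>J'\<in>insert J F. minimal_left_ideal scale M J' \<and> J' \<subseteq> I"
      proof (rule ballI)
        fix J' assume "J' \<in> insert J F"
        then show "minimal_left_ideal scale M J' \<and> J' \<subseteq> I"
        proof
          assume "J' = J"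
          then show ?thesis using \<open>minimal_left_ideal scale M J\<close> J by simp
        next
          assume "J' \<in> F"
          then show ?thesis using bspec[OF F(2)] \<open>K \<subset> I\<close> by (meson psubsetE subset_trans)
        qed
      qed
      moreover have "finite (insert J F)" using F(1) by simp
      ultimately show ?thesis
        using ballI[of I, OF dec_I] by (intro exI[of _ "insert J F"] conjI)
    qed
  qed
qed

lemma semisimple: "semisimple_algebra scale M"
proof -
  have "left_ideal scale M M"
    using subspace_M mult_in by (simp add: left_ideal_def)
  from left_ideal_decomposition[OF this] show ?thesis
    unfolding semisimple_algebra_def using unital_subalgebra by blast
qed

end


section \<open>The coproduct\<close>

context weak_bialgebra
begin

section \<open>Linearity of the coproduct and of nested Sweedler sums\<close>

lemmas counit_simps = linear_functionalD[OF counit_linear]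

lemma coproduct_add: "\<Delta> (a + b) \<beta> = \<Delta> a \<beta> + \<Delta> b \<beta>"
  and coproduct_scale: "\<Delta> (c *s a) \<beta> = c * \<Delta> a \<beta>"
  using coproduct_linear by (simp_all add: Vector_Spaces.linear_iff tensor_scale_def)

lemma coproduct_sum: "\<Delta> (\<Sum>i\<in>I. c i *s x i) \<beta> = (\<Sum>i\<in>I. c i * \<Delta> (x i) \<beta>)"
proof -
  have "Vector_Spaces.linear scale (*) (\<lambda>a. \<Delta> a \<beta>)"
    using vector_space_axioms
    by (simp add: Vector_Spaces.linear_iff vector_space_mult coproduct_add coproduct_scale)
  from linear_sum_scale[OF this] show ?thesis .
qed

text \<open>The tensor type contains arbitrary functions of the form; homogeneity in it comes from
  writing \<Delta> a as a sum of pure tensors.\<close>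

lemma coproduct_apply_scale:
  assumes \<beta>: "bilinear_map scale (*) \<beta>"
  shows "\<Delta> a (\<lambda>x y. c * \<beta> x y) = c * \<Delta> a \<beta>"
proof -
  obtain k :: nat and u v where \<Delta>: "\<Delta> a = (\<Sum>i<k. pure scale (u i) (v i))"
    using coproduct_range[of a] by (rule tensor_productE)
  have "bilinear_map scale (*) (\<lambda>x y. c * \<beta> x y)"
    using \<beta> by (simp add: bilinear_map_iff distrib_left mult.left_commute)
  then show ?thesis
    by (simp add: \<Delta> sum_pure_apply \<beta> sum_distrib_left)
qed

lemma coproduct_eqI:
  assumes "\<And>\<beta>. bilinear_map scale (*) \<beta> \<Longrightarrow> \<Delta> a \<beta> = (\<Sum>i\<in>I. \<beta> (x i) (y i))"
  shows "\<Delta> a = (\<Sum>i\<in>I. pure scale (x i) (y i))"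
proof -
  obtain k :: nat and u v where \<Delta>: "\<Delta> a = (\<Sum>i<k. pure scale (u i) (v i))"
    using coproduct_range[of a] by (rule tensor_productE)
  show ?thesis
    unfolding \<Delta> using assms by (intro sum_pure_eqI) (simp add: \<Delta> sum_pure_apply)
qed

lemma linear_sweedler_coproduct:
  assumes s: "vector_space s" and f: "bilinear_map scale s f"
  shows "Vector_Spaces.linear scale s (\<lambda>a. sweedler scale f (\<Delta> a))"
proof -
  interpret V: vector_space s by fact
  have "\<phi> (sweedler scale f (\<Delta> (a + b))) = \<phi> (sweedler scale f (\<Delta> a) + sweedler scale f (\<Delta> b))"
    and "\<phi> (sweedler scale f (\<Delta> (c *s a))) = \<phi> (s c (sweedler scale f (\<Delta> a)))"
    if "Vector_Spaces.linear s (*) \<phi>" for \<phi> a b c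
    using linear_sweedler[OF coproduct_range f that] that
    by (simp_all add: Vector_Spaces.linear_iff coproduct_add coproduct_scale)
  then show ?thesis
    using vector_space_axioms s by (simp add: Vector_Spaces.linear_iff linear_eq_iff_functionals[OF s])
qed

text \<open>The companion of \<open>linear_sweedler_coproduct\<close> for a parameter in the
  bilinear map. Together they show that the inner sums in \<open>coassoc\<close> depend bilinearly
  on the outer factors, so that the outer sums can be expanded.\<close>

lemma sweedler_linear_family:
  assumes "vector_space s" "\<And>z. bilinear_map scale s (f z)"
    and "\<And>x y. Vector_Spaces.linear scale s (\<lambda>z. f z x y)"
  shows "Vector_Spaces.linear scale s (\<lambda>z. sweedler scale (f z) (\<Delta> a))"
proof -
  interpret V: vector_space s by fact
  obtain k :: nat and u v where \<Delta>: "\<Delta> a = (\<Sum>i<k. pure scale (u i) (v i))"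
    using coproduct_range[of a] by (rule tensor_productE)
  show ?thesis
    unfolding \<Delta> sweedler_sum_pure[OF assms(1,2)]
    using assms(3) by (simp add: Vector_Spaces.linear_iff sum.distrib V.scale_sum_right)
qed

lemma pure3_bilinear:
  "bilinear_map scale tensor_scale (\<lambda>u v. pure3 scale u v z)"
  "bilinear_map scale tensor_scale (\<lambda>u v. pure3 scale x u v)"
  "bilinear_map scale tensor_scale (\<lambda>u v. pure3 scale x (y * u) v)"
  "bilinear_map scale tensor_scale (\<lambda>u v. pure3 scale x (u * y) v)"
  "bilinear_map scale tensor_scale (\<lambda>u v. pure3 scale u (v * y) z)"
  "bilinear_map scale tensor_scale (\<lambda>u v. pure3 scale u (y * v) z)"
  "Vector_Spaces.linear scale tensor_scale (pure3 scale x y)"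
  "Vector_Spaces.linear scale tensor_scale (\<lambda>x. pure3 scale x y z)"
  using trilinear_map_pure3
  by (simp_all add: bilinear_map_iff trilinear_map_iff Vector_Spaces.linear_iff
      distrib_left distrib_right scale_mult_left scale_mult_right)

section \<open>The axioms as identities between values on forms\<close>

lemma sweedler_pure3_apply:
  assumes \<tau>: "trilinear_map scale (*) \<tau>"
  shows "sweedler scale (\<lambda>u v. pure3 scale u v z) (\<Delta> a) \<tau> = \<Delta> a (\<lambda>u v. \<tau> u v z)"
    and "sweedler scale (\<lambda>u v. pure3 scale z u v) (\<Delta> a) \<tau> = \<Delta> a (\<tau> z)"
  using linear_sweedler[OF coproduct_range pure3_bilinear(1) linear_eval]
    linear_sweedler[OF coproduct_range pure3_bilinear(2) linear_eval]
  by (simp_all add: pure3_apply[OF \<tau>])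

text \<open>This threefold tensor is the left side of \<open>coassoc\<close> and, for the unit, the
  right side of both comonoidal axioms.\<close>

lemma coproduct_twice_left:
  fixes k :: nat
  assumes \<Delta>: "\<Delta> a = (\<Sum>i<k. pure scale (x i) (y i))" and \<tau>: "trilinear_map scale (*) \<tau>"
  shows "sweedler scale (\<lambda>x z. sweedler scale (\<lambda>u v. pure3 scale u v z) (\<Delta> x)) (\<Delta> a) \<tau> =
    (\<Sum>i<k. \<Delta> (x i) (\<lambda>u v. \<tau> u v (y i)))"
proof -
  have "bilinear_map scale tensor_scale (\<lambda>x z. sweedler scale (\<lambda>u v. pure3 scale u v z) (\<Delta> x))"
    unfolding bilinear_map_def
    by (intro conjI allI linear_sweedler_coproduct sweedler_linear_family vector_space_tensor_scale
        pure3_bilinear)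
  then show ?thesis
    by (simp add: \<Delta> sweedler_sum_pure[OF vector_space_tensor_scale] sum_fun_app
        sweedler_pure3_apply[OF \<tau>])
qed

lemma coassoc_apply:
  fixes k :: nat
  assumes \<Delta>: "\<Delta> a = (\<Sum>i<k. pure scale (x i) (y i))" and \<tau>: "trilinear_map scale (*) \<tau>"
  shows "(\<Sum>i<k. \<Delta> (x i) (\<lambda>u v. \<tau> u v (y i))) = (\<Sum>i<k. \<Delta> (y i) (\<tau> (x i)))"
proof -
  have "bilinear_map scale tensor_scale (\<lambda>x z. sweedler scale (\<lambda>u v. pure3 scale x u v) (\<Delta> z))"
    unfolding bilinear_map_def
    by (intro conjI allI linear_sweedler_coproduct sweedler_linear_family vector_space_tensor_scale
        pure3_bilinear)
  then have "sweedler scale (\<lambda>x z. sweedler scale (\<lambda>u v. pure3 scale x u v) (\<Delta> z)) (\<Delta> a) \<tau> =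
      (\<Sum>i<k. \<Delta> (y i) (\<tau> (x i)))"
    by (simp add: \<Delta> sweedler_sum_pure[OF vector_space_tensor_scale] sum_fun_app
        sweedler_pure3_apply[OF \<tau>])
  then show ?thesis
    using coproduct_twice_left[OF \<Delta> \<tau>] coassoc[of a] by simp
qed

lemma counit_apply:
  assumes \<phi>: "Vector_Spaces.linear scale (*) \<phi>"
  shows "\<Delta> a (\<lambda>x y. \<epsilon> x * \<phi> y) = \<phi> a" "\<Delta> a (\<lambda>x y. \<phi> x * \<epsilon> y) = \<phi> a"
proof -
  note \<phi>_simps = linear_functionalD[OF \<phi>]
  have "\<phi> (sweedler scale (\<lambda>x y. \<epsilon> x *s y) (\<Delta> a)) = \<Delta> a (\<lambda>x y. \<phi> (\<epsilon> x *s y))"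
    by (rule linear_sweedler[OF coproduct_range bilinear_map_functional_scale(1)[OF counit_linear] \<phi>])
  then show "\<Delta> a (\<lambda>x y. \<epsilon> x * \<phi> y) = \<phi> a"
    by (simp add: counit_left \<phi>_simps)
  have "\<phi> (sweedler scale (\<lambda>x y. \<epsilon> y *s x) (\<Delta> a)) = \<Delta> a (\<lambda>x y. \<phi> (\<epsilon> y *s x))"
    by (rule linear_sweedler[OF coproduct_range bilinear_map_functional_scale(2)[OF counit_linear] \<phi>])
  then show "\<Delta> a (\<lambda>x y. \<phi> x * \<epsilon> y) = \<phi> a"
    by (simp add: counit_right \<phi>_simps mult.commute)
qed

lemma coproduct_mult_apply:
  fixes k l :: nat
  assumes a: "\<Delta> a = (\<Sum>i<k. pure scale (x i) (y i))" and b: "\<Delta> b = (\<Sum>j<l. pure scale (u j) (v j))"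
    and \<beta>: "bilinear_map scale (*) \<beta>"
  shows "\<Delta> (a * b) \<beta> = (\<Sum>i<k. \<Sum>j<l. \<beta> (x i * u j) (y i * v j))"
proof -
  have inner: "bilinear_map scale tensor_scale (\<lambda>u v. pure scale (x * u) (y * v))" for x y
    using bilinear_map_pure
    by (simp add: bilinear_map_iff distrib_left distrib_right scale_mult_left scale_mult_right)
  have outer: "bilinear_map scale tensor_scale (\<lambda>x y. \<Sum>j<l. pure scale (x * u j) (y * v j))"
    using bilinear_map_pure
    by (intro bilinear_map_sum vector_space_axioms vector_space_tensor_scale)
      (simp add: bilinear_map_iff distrib_left distrib_right scale_mult_left scale_mult_right)
  show ?thesis
    unfolding coproduct_mult a b sweedler_sum_pure[OF vector_space_tensor_scale inner]
      sweedler_sum_pure[OF vector_space_tensor_scale outer]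
    by (simp add: sum_fun_app pure_apply[OF \<beta>])
qed

end


section \<open>The coproduct of the unit\<close>

text \<open>The decomposition is arbitrary here; that the factors can be taken in \<open>A_R\<close>
  and \<open>A_L\<close> is derived from it in \<open>decomposition_in_A_R_A_L\<close>.\<close>

locale unit_coproduct_decomposition = bimonoidal_weak_bialgebra scale \<Delta> \<epsilon>
  for scale :: "'k::field \<Rightarrow> 'a::{ring,monoid_mult} \<Rightarrow> 'a" (infixr \<open>*s\<close> 75) and \<Delta> \<epsilon> +
  fixes n :: nat and e f :: "nat \<Rightarrow> 'a"
  assumes coproduct_one: "\<Delta> 1 = (\<Sum>i<n. pure scale (e i) (f i))"
begin

lemma sweedler_one: "vector_space s \<Longrightarrow> bilinear_map scale s g \<Longrightarrow> sweedler scale g (\<Delta> 1) = (\<Sum>i<n. g (e i) (f i))"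
  unfolding coproduct_one by (rule sweedler_sum_pure)

lemma sum_mult_e: "(\<Sum>i<n. c i *s e i) * a = (\<Sum>i<n. c i *s (e i * a))"
  "a * (\<Sum>i<n. c i *s e i) = (\<Sum>i<n. c i *s (a * e i))"
  and sum_mult_f: "(\<Sum>i<n. c i *s f i) * a = (\<Sum>i<n. c i *s (f i * a))"
  "a * (\<Sum>i<n. c i *s f i) = (\<Sum>i<n. c i *s (a * f i))"
  by (simp_all add: sum_distrib_left sum_distrib_right scale_mult_left scale_mult_right)

lemma A_L_eq: "A_L scale \<Delta> = {\<Sum>i<n. \<phi> (e i) *s f i | \<phi>. Vector_Spaces.linear scale (*) \<phi>}"
  unfolding A_L_def
  by (rule Collect_cong, rule ex_cong1, rule rev_conj_cong, rule refl)
    (simp add: sweedler_one[OF vector_space_axioms bilinear_map_functional_scale(1)])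

lemma A_R_eq: "A_R scale \<Delta> = {\<Sum>i<n. \<phi> (f i) *s e i | \<phi>. Vector_Spaces.linear scale (*) \<phi>}"
  unfolding A_R_def
  by (rule Collect_cong, rule ex_cong1, rule rev_conj_cong, rule refl)
    (simp add: sweedler_one[OF vector_space_axioms bilinear_map_functional_scale(2)])

lemma A_L_memI: "Vector_Spaces.linear scale (*) \<phi> \<Longrightarrow> (\<Sum>i<n. \<phi> (e i) *s f i) \<in> A_L scale \<Delta>"
  and A_R_memI: "Vector_Spaces.linear scale (*) \<phi> \<Longrightarrow> (\<Sum>i<n. \<phi> (f i) *s e i) \<in> A_R scale \<Delta>"
  unfolding A_L_eq A_R_eq by blast+

lemma S_L_eq: "S_L scale \<Delta> \<epsilon> a = (\<Sum>i<n. \<epsilon> (a * f i) *s e i)"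
  and S'_L_eq: "S'_L scale \<Delta> \<epsilon> a = (\<Sum>i<n. \<epsilon> (f i * a) *s e i)"
  and S_R_eq: "S_R scale \<Delta> \<epsilon> a = (\<Sum>i<n. \<epsilon> (e i * a) *s f i)"
  and S'_R_eq: "S'_R scale \<Delta> \<epsilon> a = (\<Sum>i<n. \<epsilon> (a * e i) *s f i)"
  unfolding S_L_def S'_L_def S_R_def S'_R_def
  by (rule sweedler_one[OF vector_space_axioms] bilinear_map_functional_scale
      linear_functional_mult counit_linear)+

text \<open>The four formulas contract \<Delta> 1 with functionals of the form x \<mapsto>
  \<epsilon>(a x) or x \<mapsto> \<epsilon>(x a). Since a ranges over the whole algebra, the maps
  become linear retractions onto \<open>A_R\<close> and \<open>A_L\<close>.\<close>

lemma S_in: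
  "S_L scale \<Delta> \<epsilon> a \<in> A_R scale \<Delta>" "S'_L scale \<Delta> \<epsilon> a \<in> A_R scale \<Delta>"
  "S_R scale \<Delta> \<epsilon> a \<in> A_L scale \<Delta>" "S'_R scale \<Delta> \<epsilon> a \<in> A_L scale \<Delta>"
  unfolding S_L_eq S'_L_eq S_R_eq S'_R_eq
  using A_R_memI[of "\<lambda>x. \<epsilon> (a * x)"] A_R_memI[of "\<lambda>x. \<epsilon> (x * a)"]
    A_L_memI[of "\<lambda>x. \<epsilon> (a * x)"] A_L_memI[of "\<lambda>x. \<epsilon> (x * a)"]
  by (simp_all add: linear_functional_mult counit_linear)

lemma S_linear:
  "Vector_Spaces.linear scale scale (S_L scale \<Delta> \<epsilon>)"
  "Vector_Spaces.linear scale scale (S'_L scale \<Delta> \<epsilon>)"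
  "Vector_Spaces.linear scale scale (S_R scale \<Delta> \<epsilon>)"
  "Vector_Spaces.linear scale scale (S'_R scale \<Delta> \<epsilon>)"
  using vector_space_axioms
  by (simp_all add: Vector_Spaces.linear_iff S_L_eq S'_L_eq S_R_eq S'_R_eq distrib_left distrib_right
      scale_mult_left scale_mult_right counit_simps scale_left_distrib sum.distrib
      scale_sum_right)

lemma comonoidal_apply:
  assumes \<tau>: "trilinear_map scale (*) \<tau>"
  shows "(\<Sum>i<n. \<Sum>j<n. \<tau> (e i) (f i * e j) (f j)) = (\<Sum>i<n. \<Delta> (e i) (\<lambda>u v. \<tau> u v (f i)))"
    and "(\<Sum>i<n. \<Sum>j<n. \<tau> (e i) (e j * f i) (f j)) = (\<Sum>i<n. \<Delta> (e i) (\<lambda>u v. \<tau> u v (f i)))"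
proof -
  note sw = sweedler_one[OF vector_space_tensor_scale]
  have outer: "bilinear_map scale tensor_scale (\<lambda>x y. \<Sum>j<n. pure3 scale x (y * e j) (f j))"
    "bilinear_map scale tensor_scale (\<lambda>x y. \<Sum>j<n. pure3 scale x (e j * y) (f j))"
    by (intro bilinear_map_sum vector_space_axioms vector_space_tensor_scale pure3_bilinear)+
  show "(\<Sum>i<n. \<Sum>j<n. \<tau> (e i) (f i * e j) (f j)) = (\<Sum>i<n. \<Delta> (e i) (\<lambda>u v. \<tau> u v (f i)))"
    using fun_cong[OF comonoidal_left_right, of \<tau>]
    unfolding coproduct_twice_left[OF coproduct_one \<tau>] sw[OF pure3_bilinear(3)] sw[OF outer(1)]
    by (simp add: sum_fun_app pure3_apply[OF \<tau>])
  show "(\<Sum>i<n. \<Sum>j<n. \<tau> (e i) (e j * f i) (f j)) = (\<Sum>i<n. \<Delta> (e i) (\<lambda>u v. \<tau> u v (f i)))"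
    using fun_cong[OF comonoidal_right_left, of \<tau>]
    unfolding coproduct_twice_left[OF coproduct_one \<tau>] sw[OF pure3_bilinear(4)] sw[OF outer(2)]
    by (simp add: sum_fun_app pure3_apply[OF \<tau>])
qed

text \<open>Multiplicativity of \<Delta> at 1 * 1 = 1, transported to vector-valued bilinear maps by
  testing with functionals.\<close>

lemma coproduct_one_idempotent:
  assumes s: "vector_space s" and g: "bilinear_map scale s g"
  shows "(\<Sum>i<n. \<Sum>j<n. g (e i * e j) (f i * f j)) = (\<Sum>i<n. g (e i) (f i))"
proof -
  have "\<phi> (\<Sum>i<n. \<Sum>j<n. g (e i * e j) (f i * f j)) = \<phi> (\<Sum>i<n. g (e i) (f i))"
    if \<phi>: "Vector_Spaces.linear s (*) \<phi>" for \<phi>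
  proof -
    note \<phi>_simps = linear_functionalD[OF \<phi>]
    have \<beta>: "bilinear_map scale (*) (\<lambda>x y. \<phi> (g x y))"
      using g vector_space_mult by (simp add: bilinear_map_iff \<phi>_simps)
    have "(\<Sum>i<n. \<Sum>j<n. \<phi> (g (e i * e j) (f i * f j))) = \<Delta> (1 * 1) (\<lambda>x y. \<phi> (g x y))"
      by (rule coproduct_mult_apply[OF coproduct_one coproduct_one \<beta>, symmetric])
    then show ?thesis
      by (simp add: coproduct_one sum_pure_apply[OF \<beta>] \<phi>_simps)
  qed
  then show ?thesis by (simp add: linear_eq_iff_functionals[OF s])
qed

text \<open>Applying the counit to the middle factor of \<open>\<Delta>\<^sup>2 1\<close>.\<close>

lemma middle_counit:
  assumes s: "vector_space s" and g: "bilinear_map scale s g"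
  shows "(\<Sum>i<n. g (e i) (S_R scale \<Delta> \<epsilon> (f i))) = (\<Sum>i<n. g (e i) (f i))"
    and "(\<Sum>i<n. g (e i) (S'_R scale \<Delta> \<epsilon> (f i))) = (\<Sum>i<n. g (e i) (f i))"
    and "(\<Sum>i<n. g (S_L scale \<Delta> \<epsilon> (e i)) (f i)) = (\<Sum>i<n. g (e i) (f i))"
    and "(\<Sum>i<n. g (S'_L scale \<Delta> \<epsilon> (e i)) (f i)) = (\<Sum>i<n. g (e i) (f i))"
proof -
  interpret S: vector_space s by fact
  have counit: "(\<Sum>i<n. \<Sum>j<n. s (\<epsilon> (f i * e j)) (g (e i) (f j))) = (\<Sum>i<n. g (e i) (f i))"
    "(\<Sum>i<n. \<Sum>j<n. s (\<epsilon> (e j * f i)) (g (e i) (f j))) = (\<Sum>i<n. g (e i) (f i))"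
  proof -
    have "\<phi> (\<Sum>i<n. \<Sum>j<n. s (\<epsilon> (f i * e j)) (g (e i) (f j))) = \<phi> (\<Sum>i<n. g (e i) (f i)) \<and>
      \<phi> (\<Sum>i<n. \<Sum>j<n. s (\<epsilon> (e j * f i)) (g (e i) (f j))) = \<phi> (\<Sum>i<n. g (e i) (f i))"
      if \<phi>: "Vector_Spaces.linear s (*) \<phi>" for \<phi>
    proof -
      note \<phi>_simps = linear_functionalD[OF \<phi>]
      \<comment> \<open>This form puts the counit in the middle slot. On the coproduct of e_i next
        to f_i it gives \<phi>(g e_i f_i) by the right counit axiom; on the two comonoidal products
        it gives the two double sums.\<close>
      have \<tau>: "trilinear_map scale (*) (\<lambda>u v w. \<phi> (g u w) * \<epsilon> v)"
        using g vector_space_mult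
        by (simp add: bilinear_map_iff trilinear_map_iff \<phi>_simps counit_simps
            distrib_left distrib_right mult.assoc mult.left_commute)
      have "Vector_Spaces.linear scale (*) (\<lambda>u. \<phi> (g u w))" for w
        using g vector_space_mult by (simp add: bilinear_map_iff Vector_Spaces.linear_iff \<phi>_simps)
      then have "\<Delta> (e i) (\<lambda>u v. \<phi> (g u w) * \<epsilon> v) = \<phi> (g (e i) w)" for i w
        by (rule counit_apply)
      then have "(\<Sum>i<n. \<Sum>j<n. \<phi> (g (e i) (f j)) * \<epsilon> (f i * e j)) = (\<Sum>i<n. \<phi> (g (e i) (f i)))"
        "(\<Sum>i<n. \<Sum>j<n. \<phi> (g (e i) (f j)) * \<epsilon> (e j * f i)) = (\<Sum>i<n. \<phi> (g (e i) (f i)))"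
        using comonoidal_apply[OF \<tau>] by simp_all
      then show ?thesis
        unfolding \<phi>_simps by (simp only: mult.commute)
    qed
    then show "(\<Sum>i<n. \<Sum>j<n. s (\<epsilon> (f i * e j)) (g (e i) (f j))) = (\<Sum>i<n. g (e i) (f i))"
      "(\<Sum>i<n. \<Sum>j<n. s (\<epsilon> (e j * f i)) (g (e i) (f j))) = (\<Sum>i<n. g (e i) (f i))"
      by (simp_all add: linear_eq_iff_functionals[OF s])
  qed
  note left = linear_sum_scale[OF bilinear_map_linear_left[OF g]]
    and right = linear_sum_scale[OF bilinear_map_linear_right[OF g]]
  show "(\<Sum>i<n. g (e i) (S_R scale \<Delta> \<epsilon> (f i))) = (\<Sum>i<n. g (e i) (f i))"
    "(\<Sum>i<n. g (e i) (S'_R scale \<Delta> \<epsilon> (f i))) = (\<Sum>i<n. g (e i) (f i))"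
    unfolding S_R_eq S'_R_eq right by (fact counit(2), fact counit(1))
  \<comment> \<open>Here the inner sum produces the first factor, so the summation indices trade
    roles before the double sums match.\<close>
  show "(\<Sum>i<n. g (S_L scale \<Delta> \<epsilon> (e i)) (f i)) = (\<Sum>i<n. g (e i) (f i))"
    unfolding S_L_eq left by (rule trans[OF sum.swap counit(2)])
  show "(\<Sum>i<n. g (S'_L scale \<Delta> \<epsilon> (e i)) (f i)) = (\<Sum>i<n. g (e i) (f i))"
    unfolding S'_L_eq left by (rule trans[OF sum.swap counit(1)])
qed

text \<open>Contract the first factor in \<open>middle_counit\<close> with the functional that
  produces l from \<Delta> 1.\<close>

lemma A_L_fixed:
  assumes "l \<in> A_L scale \<Delta>"
  shows "S_R scale \<Delta> \<epsilon> l = l" "S'_R scale \<Delta> \<epsilon> l = l"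
proof -
  obtain \<phi> where \<phi>: "Vector_Spaces.linear scale (*) \<phi>" and l: "l = (\<Sum>i<n. \<phi> (e i) *s f i)"
    using assms by (auto simp: A_L_eq)
  show "S_R scale \<Delta> \<epsilon> l = l" "S'_R scale \<Delta> \<epsilon> l = l"
    using middle_counit(1,2)[OF vector_space_axioms bilinear_map_functional_scale(1)[OF \<phi>]]
    by (simp_all add: l linear_sum_scale[OF S_linear(3)] linear_sum_scale[OF S_linear(4)])
qed

lemma A_R_fixed:
  assumes "r \<in> A_R scale \<Delta>"
  shows "S_L scale \<Delta> \<epsilon> r = r" "S'_L scale \<Delta> \<epsilon> r = r"
proof -
  obtain \<phi> where \<phi>: "Vector_Spaces.linear scale (*) \<phi>" and r: "r = (\<Sum>i<n. \<phi> (f i) *s e i)"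
    using assms by (auto simp: A_R_eq)
  show "S_L scale \<Delta> \<epsilon> r = r" "S'_L scale \<Delta> \<epsilon> r = r"
    using middle_counit(3,4)[OF vector_space_axioms bilinear_map_functional_scale(2)[OF \<phi>]]
    by (simp_all add: r linear_sum_scale[OF S_linear(1)] linear_sum_scale[OF S_linear(2)])
qed

section \<open>Consequences of monoidality at the unit\<close>

lemma monoidal_one:
  "(\<Sum>i<n. \<epsilon> (a * e i) * \<epsilon> (f i * b)) = \<epsilon> (a * b)"
  "(\<Sum>i<n. \<epsilon> (a * f i) * \<epsilon> (e i * b)) = \<epsilon> (a * b)"
proof -
  have "bilinear_map scale (*) (\<lambda>x y. \<epsilon> (a * x) * \<epsilon> (y * b))"
    "bilinear_map scale (*) (\<lambda>x y. \<epsilon> (a * y) * \<epsilon> (x * b))"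
    using vector_space_axioms vector_space_mult
    by (simp_all add: bilinear_map_iff distrib_left distrib_right scale_mult_left scale_mult_right
      counit_simps mult.left_commute)
  then show "(\<Sum>i<n. \<epsilon> (a * e i) * \<epsilon> (f i * b)) = \<epsilon> (a * b)"
    "(\<Sum>i<n. \<epsilon> (a * f i) * \<epsilon> (e i * b)) = \<epsilon> (a * b)"
    using monoidal_12[of a 1 b] monoidal_21[of a 1 b] by (simp_all add: sweedler_one[OF vector_space_mult])
qed

lemma counit_mult_S:
  "\<epsilon> (a * S_R scale \<Delta> \<epsilon> b) = \<epsilon> (a * b)" "\<epsilon> (a * S'_L scale \<Delta> \<epsilon> b) = \<epsilon> (a * b)"
  "\<epsilon> (S_L scale \<Delta> \<epsilon> a * b) = \<epsilon> (a * b)"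
  using monoidal_one[of a b]
  by (simp_all add: S_R_eq S'_L_eq S_L_eq sum_mult_e sum_mult_f counit_simps mult.commute)

text \<open>Expanding both sides gives \<epsilon>(a S_L(b)) = \<epsilon>(b S'_R(a)) for all a and b;
  then S'_R fixes \<open>A_L\<close> and S_L fixes \<open>A_R\<close>.\<close>

lemma counit_modular:
  "a \<in> A_L scale \<Delta> \<Longrightarrow> \<epsilon> (a * S_L scale \<Delta> \<epsilon> b) = \<epsilon> (b * a)"
  "a \<in> A_R scale \<Delta> \<Longrightarrow> \<epsilon> (a * S'_R scale \<Delta> \<epsilon> b) = \<epsilon> (b * a)"
proof -
  have "\<epsilon> (a * S_L scale \<Delta> \<epsilon> b) = \<epsilon> (b * S'_R scale \<Delta> \<epsilon> a)" for a b
    by (simp add: S_L_eq S'_R_eq sum_mult_e sum_mult_f counit_simps mult.commute)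
  then show "a \<in> A_L scale \<Delta> \<Longrightarrow> \<epsilon> (a * S_L scale \<Delta> \<epsilon> b) = \<epsilon> (b * a)"
    and "a \<in> A_R scale \<Delta> \<Longrightarrow> \<epsilon> (a * S'_R scale \<Delta> \<epsilon> b) = \<epsilon> (b * a)"
    using A_L_fixed(2)[of a] A_R_fixed(1)[of a] by metis+
qed

section \<open>The unital subalgebras \<open>A_L\<close> and \<open>A_R\<close>\<close>

text \<open>If l = \<phi>(e_i) f_i, then \<Delta> l is the twice-applied coproduct of 1 with its
  first factor contracted by \<phi>. The two comonoidal expressions for it leave l on either side of
  e_j.\<close>

lemma coproduct_A_L:
  assumes "l \<in> A_L scale \<Delta>"
  shows "\<Delta> l = (\<Sum>i<n. pure scale (l * e i) (f i))" "\<Delta> l = (\<Sum>i<n. pure scale (e i * l) (f i))"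
proof -
  obtain \<phi> where \<phi>: "Vector_Spaces.linear scale (*) \<phi>" and l: "l = (\<Sum>i<n. \<phi> (e i) *s f i)"
    using assms by (auto simp: A_L_eq)
  have \<Delta>: "\<Delta> l \<beta> = (\<Sum>i<n. \<beta> (l * e i) (f i)) \<and> \<Delta> l \<beta> = (\<Sum>i<n. \<beta> (e i * l) (f i))"
    if \<beta>: "bilinear_map scale (*) \<beta>" for \<beta>
  proof -
    have \<tau>: "trilinear_map scale (*) (\<lambda>u v w. \<phi> u * \<beta> v w)"
      using \<phi> \<beta> by (simp add: bilinear_map_iff trilinear_map_iff Vector_Spaces.linear_iff
          distrib_left distrib_right mult.assoc mult.left_commute)
    note left = linear_sum_scale[OF bilinear_map_linear_left[OF \<beta>]]
    have "\<Delta> l \<beta> = (\<Sum>i<n. \<Delta> (f i) (\<lambda>v w. \<phi> (e i) * \<beta> v w))"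
      by (simp add: l coproduct_sum coproduct_apply_scale[OF \<beta>])
    \<comment> \<open>Coassociativity moves the coproduct from f_i to e_i, the shape in which
      comonoidality is stated.\<close>
    also have "\<dots> = (\<Sum>i<n. \<Delta> (e i) (\<lambda>u v. \<phi> u * \<beta> v (f i)))"
      by (rule coassoc_apply[OF coproduct_one \<tau>, symmetric])
    finally have "\<Delta> l \<beta> = (\<Sum>i<n. \<Sum>j<n. \<phi> (e i) * \<beta> (f i * e j) (f j))"
      "\<Delta> l \<beta> = (\<Sum>i<n. \<Sum>j<n. \<phi> (e i) * \<beta> (e j * f i) (f j))"
      using comonoidal_apply[OF \<tau>] by simp_all
    then show ?thesis
      unfolding l sum_mult_f left by (subst (1 2) sum.swap) simp
  qed
  show "\<Delta> l = (\<Sum>i<n. pure scale (l * e i) (f i))" "\<Delta> l = (\<Sum>i<n. pure scale (e i * l) (f i))"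
    by (rule coproduct_eqI, use \<Delta> in blast)+
qed

text \<open>The same contraction in the third factor, where the coproduct already acts on
  e_i.\<close>

lemma coproduct_A_R:
  assumes "r \<in> A_R scale \<Delta>"
  shows "\<Delta> r = (\<Sum>i<n. pure scale (e i) (f i * r))" "\<Delta> r = (\<Sum>i<n. pure scale (e i) (r * f i))"
proof -
  obtain \<phi> where \<phi>: "Vector_Spaces.linear scale (*) \<phi>" and r: "r = (\<Sum>i<n. \<phi> (f i) *s e i)"
    using assms by (auto simp: A_R_eq)
  have \<Delta>: "\<Delta> r \<beta> = (\<Sum>i<n. \<beta> (e i) (f i * r)) \<and> \<Delta> r \<beta> = (\<Sum>i<n. \<beta> (e i) (r * f i))"
    if \<beta>: "bilinear_map scale (*) \<beta>" for \<beta>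
  proof -
    have \<tau>: "trilinear_map scale (*) (\<lambda>u v w. \<phi> w * \<beta> u v)"
      using \<phi> \<beta> by (simp add: bilinear_map_iff trilinear_map_iff Vector_Spaces.linear_iff
          distrib_left distrib_right mult.assoc mult.left_commute)
    note right = linear_sum_scale[OF bilinear_map_linear_right[OF \<beta>]]
    have "\<Delta> r \<beta> = (\<Sum>i<n. \<Delta> (e i) (\<lambda>u v. \<phi> (f i) * \<beta> u v))"
      by (simp add: r coproduct_sum coproduct_apply_scale[OF \<beta>])
    then have "\<Delta> r \<beta> = (\<Sum>i<n. \<Sum>j<n. \<phi> (f j) * \<beta> (e i) (f i * e j))"
      "\<Delta> r \<beta> = (\<Sum>i<n. \<Sum>j<n. \<phi> (f j) * \<beta> (e i) (e j * f i))"
      using comonoidal_apply[OF \<tau>] by simp_all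
    then show ?thesis
      unfolding r sum_mult_e right by simp
  qed
  show "\<Delta> r = (\<Sum>i<n. pure scale (e i) (f i * r))" "\<Delta> r = (\<Sum>i<n. pure scale (e i) (r * f i))"
    by (rule coproduct_eqI, use \<Delta> in blast)+
qed

text \<open>\<open>A_L\<close> is the range of the linear map S_R, which takes values in
  \<open>A_L\<close> and fixes it.\<close>

lemma subspace_A_L: "subspace (A_L scale \<Delta>)"
proof -
  interpret S: Vector_Spaces.linear scale scale "S_R scale \<Delta> \<epsilon>" by (fact S_linear)
  have "A_L scale \<Delta> = range (S_R scale \<Delta> \<epsilon>)"
    using S_in(3) A_L_fixed(1) by (metis rangeI subsetI subset_antisym image_subsetI)
  then show ?thesis using S.subspace_image[OF subspace_UNIV] by simp
qed

lemma subspace_A_R: "subspace (A_R scale \<Delta>)"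
proof -
  interpret S: Vector_Spaces.linear scale scale "S_L scale \<Delta> \<epsilon>" by (fact S_linear)
  have "A_R scale \<Delta> = range (S_L scale \<Delta> \<epsilon>)"
    using S_in(1) A_R_fixed(1) by (metis rangeI subsetI subset_antisym image_subsetI)
  then show ?thesis using S.subspace_image[OF subspace_UNIV] by simp
qed

lemma one_eq: "(\<Sum>i<n. \<epsilon> (e i) *s f i) = 1" "(\<Sum>i<n. \<epsilon> (f i) *s e i) = 1"
  using counit_left[of 1] counit_right[of 1] bilinear_map_functional_scale[OF counit_linear]
  by (simp_all add: sweedler_one[OF vector_space_axioms])

lemma one_in: "1 \<in> A_L scale \<Delta>" "1 \<in> A_R scale \<Delta>"
  using A_L_memI[OF counit_linear] A_R_memI[OF counit_linear] by (simp_all add: one_eq)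

text \<open>By idempotence of \<Delta> 1, the coproduct of l l' is l e_i l' \<otimes> f_i; the
  counit in the first factor then exhibits l l' as a contraction of \<Delta> 1.\<close>

lemma A_L_mult:
  assumes l: "l \<in> A_L scale \<Delta>" and l': "l' \<in> A_L scale \<Delta>"
  shows "l * l' \<in> A_L scale \<Delta>"
proof -
  have "\<phi> (l * l') = \<phi> (\<Sum>i<n. \<epsilon> (l * e i * l') *s f i)"
    if \<phi>: "Vector_Spaces.linear scale (*) \<phi>" for \<phi>
  proof -
    note \<phi>_simps = linear_functionalD[OF \<phi>]
    have \<beta>: "bilinear_map scale (*) (\<lambda>x y. \<epsilon> x * \<phi> y)" "bilinear_map scale (*) (\<lambda>x y. \<epsilon> (l * x * l') * \<phi> y)"
      using vector_space_axioms vector_space_mult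
      by (simp_all add: bilinear_map_iff counit_simps \<phi>_simps distrib_left distrib_right
          scale_mult_left scale_mult_right mult.left_commute)
    have "\<phi> (l * l') = \<Delta> (l * l') (\<lambda>x y. \<epsilon> x * \<phi> y)"
      by (rule counit_apply[OF \<phi>, symmetric])
    \<comment> \<open>Opposite forms of \<open>coproduct_A_L\<close> are used for l and l', so that
      both stay outside the product e_i e_j.\<close>
    also have "\<dots> = (\<Sum>i<n. \<Sum>j<n. \<epsilon> (l * (e i * e j) * l') * \<phi> (f i * f j))"
      using coproduct_mult_apply[OF coproduct_A_L(1)[OF l] coproduct_A_L(2)[OF l'] \<beta>(1)]
      by (simp add: mult.assoc)
    also have "\<dots> = (\<Sum>i<n. \<epsilon> (l * e i * l') * \<phi> (f i))"
      by (rule coproduct_one_idempotent[OF vector_space_mult \<beta>(2)])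
    finally show ?thesis by (simp add: \<phi>_simps)
  qed
  then have "l * l' = (\<Sum>i<n. \<epsilon> (l * e i * l') *s f i)"
    by (simp add: linear_eq_iff_functionals[OF vector_space_axioms])
  moreover have "Vector_Spaces.linear scale (*) (\<lambda>x. \<epsilon> (l * x * l'))"
    using linear_functional_mult(1)[OF linear_functional_mult(2)[OF counit_linear]] .
  ultimately show ?thesis using A_L_memI[of "\<lambda>x. \<epsilon> (l * x * l')"] by simp
qed

text \<open>The mirror argument: the coproduct of r r' is e_i \<otimes> r f_i r', and the counit
  goes into the second factor.\<close>

lemma A_R_mult:
  assumes r: "r \<in> A_R scale \<Delta>" and r': "r' \<in> A_R scale \<Delta>"
  shows "r * r' \<in> A_R scale \<Delta>"
proof -
  have "\<phi> (r * r') = \<phi> (\<Sum>i<n. \<epsilon> (r * f i * r') *s e i)"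
    if \<phi>: "Vector_Spaces.linear scale (*) \<phi>" for \<phi>
  proof -
    note \<phi>_simps = linear_functionalD[OF \<phi>]
    have \<beta>: "bilinear_map scale (*) (\<lambda>x y. \<phi> x * \<epsilon> y)" "bilinear_map scale (*) (\<lambda>x y. \<phi> x * \<epsilon> (r * y * r'))"
      using vector_space_axioms vector_space_mult
      by (simp_all add: bilinear_map_iff counit_simps \<phi>_simps distrib_left distrib_right
          scale_mult_left scale_mult_right mult.left_commute)
    have "\<phi> (r * r') = \<Delta> (r * r') (\<lambda>x y. \<phi> x * \<epsilon> y)"
      by (rule counit_apply[OF \<phi>, symmetric])
    also have "\<dots> = (\<Sum>i<n. \<Sum>j<n. \<phi> (e i * e j) * \<epsilon> (r * (f i * f j) * r'))"
      using coproduct_mult_apply[OF coproduct_A_R(2)[OF r] coproduct_A_R(1)[OF r'] \<beta>(1)]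
      by (simp add: mult.assoc)
    also have "\<dots> = (\<Sum>i<n. \<phi> (e i) * \<epsilon> (r * f i * r'))"
      by (rule coproduct_one_idempotent[OF vector_space_mult \<beta>(2)])
    finally show ?thesis by (simp add: \<phi>_simps mult.commute)
  qed
  then have "r * r' = (\<Sum>i<n. \<epsilon> (r * f i * r') *s e i)"
    by (simp add: linear_eq_iff_functionals[OF vector_space_axioms])
  moreover have "Vector_Spaces.linear scale (*) (\<lambda>x. \<epsilon> (r * x * r'))"
    using linear_functional_mult(1)[OF linear_functional_mult(2)[OF counit_linear]] .
  ultimately show ?thesis using A_R_memI[of "\<lambda>x. \<epsilon> (r * x * r')"] by simp
qed

lemma unital_subalgebras:
  "unital_subalgebra scale (A_L scale \<Delta>)" "unital_subalgebra scale (A_R scale \<Delta>)"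
  unfolding unital_subalgebra_def
  using subspace_A_L subspace_A_R one_in A_L_mult A_R_mult by blast+

text \<open>Two uses of \<open>middle_counit\<close> absorb S_L in the first factor and S_R in the
  second.\<close>

lemma decomposition_in_A_R_A_L:
  "\<Delta> 1 = (\<Sum>i<n. pure scale (S_L scale \<Delta> \<epsilon> (e i)) (S_R scale \<Delta> \<epsilon> (f i)))"
  using middle_counit(3)[OF vector_space_tensor_scale
      bilinear_map_linear_comp(2)[OF bilinear_map_pure S_linear(3)]]
    middle_counit(1)[OF vector_space_tensor_scale bilinear_map_pure]
  by (simp add: coproduct_one)

end


section \<open>The counit on \<open>A\<^sub>L\<close> and \<open>A\<^sub>R\<close>\<close>

locale adapted_unit_coproduct_decomposition = unit_coproduct_decomposition +
  assumes e_in: "i < n \<Longrightarrow> e i \<in> A_R scale \<Delta>" and f_in: "i < n \<Longrightarrow> f i \<in> A_L scale \<Delta>"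
begin

text \<open>The two expansions of m turn into S'_R(m) and S_R(S'_L(m)), both equal to m on
  \<open>A_L\<close> because the counit absorbs S_R and S'_L on the right.\<close>

sublocale left: functional_of_index_one scale "A_L scale \<Delta>" \<epsilon> n "\<lambda>i. S_R scale \<Delta> \<epsilon> (e i)" f
proof (intro functional_of_index_one.intro functional_with_quasi_basis.intro
    functional_with_quasi_basis_axioms.intro functional_of_index_one_axioms.intro fin_dim_algebra_axioms)
  show "(\<Sum>i<n. \<epsilon> (m * S_R scale \<Delta> \<epsilon> (e i)) *s f i) = m" if "m \<in> A_L scale \<Delta>" for m
    using A_L_fixed(2)[OF that] by (simp add: counit_mult_S flip: S'_R_eq)
  show "(\<Sum>i<n. \<epsilon> (f i * m) *s S_R scale \<Delta> \<epsilon> (e i)) = m" if "m \<in> A_L scale \<Delta>" for m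
  proof -
    have "(\<Sum>i<n. \<epsilon> (f i * m) *s S_R scale \<Delta> \<epsilon> (e i)) = S_R scale \<Delta> \<epsilon> (S'_L scale \<Delta> \<epsilon> m)"
      by (simp add: S'_L_eq linear_sum_scale[OF S_linear(3)])
    also have "\<dots> = S_R scale \<Delta> \<epsilon> m"
      by (simp add: S_R_eq counit_mult_S)
    finally show ?thesis by (simp add: A_L_fixed that)
  qed
  \<comment> \<open>The index becomes \<epsilon>(e_j e_i) f_j f_i, a contraction of the square of
    \<Delta> 1; idempotence reduces it to \<epsilon>(e_i) f_i = 1.\<close>
  have "(\<Sum>i<n. S_R scale \<Delta> \<epsilon> (e i) * f i) = (\<Sum>i<n. \<Sum>j<n. \<epsilon> (e j * e i) *s (f j * f i))"
    by (simp add: S_R_eq sum_mult_f)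
  also have "\<dots> = (\<Sum>j<n. \<Sum>i<n. \<epsilon> (e j * e i) *s (f j * f i))"
    by (rule sum.swap)
  also have "\<dots> = (\<Sum>i<n. \<epsilon> (e i) *s f i)"
    by (rule coproduct_one_idempotent[OF vector_space_axioms bilinear_map_functional_scale(1)[OF counit_linear]])
  finally show "(\<Sum>i<n. S_R scale \<Delta> \<epsilon> (e i) * f i) = 1"
    by (simp add: one_eq)
qed (use unital_subalgebras counit_linear S_in f_in in simp_all)

sublocale right: functional_of_index_one scale "A_R scale \<Delta>" \<epsilon> n e "\<lambda>i. S_L scale \<Delta> \<epsilon> (f i)"
proof (intro functional_of_index_one.intro functional_with_quasi_basis.intro
    functional_with_quasi_basis_axioms.intro functional_of_index_one_axioms.intro fin_dim_algebra_axioms)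
  show "(\<Sum>i<n. \<epsilon> (m * e i) *s S_L scale \<Delta> \<epsilon> (f i)) = m" if "m \<in> A_R scale \<Delta>" for m
  proof -
    have "(\<Sum>i<n. \<epsilon> (m * e i) *s S_L scale \<Delta> \<epsilon> (f i)) = S_L scale \<Delta> \<epsilon> (S'_R scale \<Delta> \<epsilon> m)"
      by (simp add: S'_R_eq linear_sum_scale[OF S_linear(1)])
    also have "\<dots> = (\<Sum>i<n. \<epsilon> (S'_R scale \<Delta> \<epsilon> m * f i) *s e i)"
      by (rule S_L_eq)
    \<comment> \<open>Monoidality in the form \<epsilon>(S'_R(m) f_i) = \<epsilon>(m f_i).\<close>
    also have "\<dots> = S_L scale \<Delta> \<epsilon> m"
      using monoidal_one(1)[of m]
      by (simp add: S_L_eq S'_R_eq sum_mult_f counit_simps)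
    finally show ?thesis by (simp add: A_R_fixed that)
  qed
  show "(\<Sum>i<n. \<epsilon> (S_L scale \<Delta> \<epsilon> (f i) * m) *s e i) = m" if "m \<in> A_R scale \<Delta>" for m
    using A_R_fixed(2)[OF that] by (simp add: counit_mult_S flip: S'_L_eq)
  have "(\<Sum>i<n. e i * S_L scale \<Delta> \<epsilon> (f i)) = (\<Sum>i<n. \<Sum>j<n. \<epsilon> (f i * f j) *s (e i * e j))"
    by (simp add: S_L_eq sum_mult_e)
  also have "\<dots> = (\<Sum>i<n. \<epsilon> (f i) *s e i)"
    by (rule coproduct_one_idempotent[OF vector_space_axioms bilinear_map_functional_scale(2)[OF counit_linear]])
  finally show "(\<Sum>i<n. e i * S_L scale \<Delta> \<epsilon> (f i)) = 1"
    by (simp add: one_eq)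
qed (use unital_subalgebras counit_linear S_in e_in in simp_all)

section \<open>Quasi-bases and modular automorphisms of the counit\<close>

lemma quasi_basis_left:
  "quasi_basis scale (A_L scale \<Delta>) \<epsilon> = sweedler scale (\<lambda>x y. pure scale (S_R scale \<Delta> \<epsilon> x) y) (\<Delta> 1)"
  unfolding left.quasi_basis_eq
  by (rule sweedler_one[OF vector_space_tensor_scale
      bilinear_map_linear_comp(1)[OF bilinear_map_pure S_linear(3)], symmetric])

lemma quasi_basis_right:
  "quasi_basis scale (A_R scale \<Delta>) \<epsilon> = sweedler scale (\<lambda>x y. pure scale x (S_L scale \<Delta> \<epsilon> y)) (\<Delta> 1)"
  unfolding right.quasi_basis_eq
  by (rule sweedler_one[OF vector_space_tensor_scale
      bilinear_map_linear_comp(2)[OF bilinear_map_pure S_linear(1)], symmetric])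

text \<open>The modular identity is \<epsilon>(b S_R(S_L(a))) = \<epsilon>(b S_L(a)) = \<epsilon>(a
  b) for b in \<open>A_L\<close>.\<close>

lemma modular_left:
  "is_modular_automorphism scale (A_L scale \<Delta>) \<epsilon> (S_R scale \<Delta> \<epsilon> \<circ> S_L scale \<Delta> \<epsilon>)"
  by (rule left.is_modular_automorphismI) (simp_all add: S_in counit_mult_S counit_modular)

lemma modular_right:
  "is_modular_automorphism scale (A_R scale \<Delta>) \<epsilon> (S'_L scale \<Delta> \<epsilon> \<circ> S'_R scale \<Delta> \<epsilon>)"
  by (rule right.is_modular_automorphismI) (simp_all add: S_in counit_mult_S counit_modular)

end

lemma (in bimonoidal_weak_bialgebra) ex_adapted_decomposition:
  "\<exists>n e f. adapted_unit_coproduct_decomposition scale \<Delta> \<epsilon> n e f"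
proof -
  obtain n :: nat and e f where "\<Delta> 1 = (\<Sum>i<n. pure scale (e i) (f i))"
    using coproduct_range[of 1] by (rule tensor_productE)
  then interpret unit_coproduct_decomposition scale \<Delta> \<epsilon> n e f
    by unfold_locales
  have "adapted_unit_coproduct_decomposition scale \<Delta> \<epsilon> n
    (\<lambda>i. S_L scale \<Delta> \<epsilon> (e i)) (\<lambda>i. S_R scale \<Delta> \<epsilon> (f i))"
    by unfold_locales (simp_all only: S_in flip: decomposition_in_A_R_A_L)
  then show ?thesis by blast
qed

theorem proposition5p2:
  fixes scale :: "'k::field \<Rightarrow> 'a::{ring,monoid_mult} \<Rightarrow> 'a"
    and \<Delta> :: "'a \<Rightarrow> ('a, 'k) tensor" and \<epsilon> :: "'a \<Rightarrow> 'k"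
  assumes "bimonoidal_weak_bialgebra scale \<Delta> \<epsilon>"
  defines "AL \<equiv> A_L scale \<Delta>" and "AR \<equiv> A_R scale \<Delta>"
  shows
    "(nondegenerate_on AL \<epsilon> \<and> Ind scale AL \<epsilon> = 1 \<and>
      nondegenerate_on AR \<epsilon> \<and> Ind scale AR \<epsilon> = 1) \<and>
     ((\<exists>!q. is_quasi_basis scale AL \<epsilon> q) \<and>
      quasi_basis scale AL \<epsilon> = sweedler scale (\<lambda>x y. pure scale (S_R scale \<Delta> \<epsilon> x) y) (\<Delta> 1) \<and>
      (\<exists>!q. is_quasi_basis scale AR \<epsilon> q) \<and>
      quasi_basis scale AR \<epsilon> = sweedler scale (\<lambda>x y. pure scale x (S_L scale \<Delta> \<epsilon> y)) (\<Delta> 1)) \<and>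
     (is_modular_automorphism scale AL \<epsilon> (S_R scale \<Delta> \<epsilon> \<circ> S_L scale \<Delta> \<epsilon>) \<and>
      is_modular_automorphism scale AR \<epsilon> (S'_L scale \<Delta> \<epsilon> \<circ> S'_R scale \<Delta> \<epsilon>)) \<and>
     (separable_algebra scale AL \<and> semisimple_algebra scale AL \<and>
      separable_algebra scale AR \<and> semisimple_algebra scale AR)"
proof -
  interpret bimonoidal_weak_bialgebra scale \<Delta> \<epsilon> by fact
  obtain n e f where "adapted_unit_coproduct_decomposition scale \<Delta> \<epsilon> n e f"
    using ex_adapted_decomposition by blast
  then interpret adapted_unit_coproduct_decomposition scale \<Delta> \<epsilon> n e f .
  show ?thesis
    unfolding AL_def AR_def
    by (intro conjI left.nondegenerate right.nondegenerate left.ex1_quasi_basis right.ex1_quasi_basis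
        quasi_basis_left quasi_basis_right modular_left modular_right left.separable left.semisimple
        right.separable right.semisimple left.Ind_eq[THEN trans, OF left.index_one]
        right.Ind_eq[THEN trans, OF right.index_one])
qed

end
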